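(* Let $\mathcal{C}$ be an idempotent Mal'cev clone on $\{0,1,2\}$ that contains a majority operation and preserves $\mu_2$. (1) If $\mathcal{C}$ does not preserve $\psi_2$, then $\mathcal{C}\equiv_{\mathrm{m}}\mathcal{C}_2$ or $\mathcal{C}\equiv_{\mathrm{m}}\mathcal{I}_2$. (2) If $\mathcal{C}$ preserves $\psi_2$ but not $\rho_2$, then $\mathcal{C}\equiv_{\mathrm{m}}\mathrm{Pol}(\mathbb{M}_1)$. (3) If $\mathcal{C}$ preserves both $\psi_2$ and $\rho_2$, then $\mathcal{C}\equiv_{\mathrm{m}}\mathrm{Pol}(\mathbb{M}_0)$. Furthermore, $\mathrm{Pol}(\mathbb{M}_0)\leq_{\mathrm{m}}\mathrm{Pol}(\mathbb{M}_1)\leq_{\mathrm{m}}\mathcal{C}_2\leq_{\mathrm{m}}\mathcal{I}_2$, and these four clones are pairwise not minor-equivalent.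
   Context: A clone is idempotent if $f(x,\dots,x)\approx x$ for all its operations; it is Mal'cev if it contains $d$ with $d(y,x,x)\approx d(x,x,y)\approx y$; a majority operation $m$ satisfies $m(x,y,y)\approx m(y,x,y)\approx m(y,y,x)\approx y$. $\mathrm{Pol}(\Gamma)$ is the clone of operations preserving all relations in $\Gamma$. For an $n$-ary $f$ and $\sigma\colon[n]\to[r]$, $f_\sigma(x_1,\dots,x_r)=f(x_{\sigma(1)},\dots,x_{\sigma(n)})$; a minion homomorphism is an arity-preserving map $\xi$ between clones with $\xi(f_\sigma)=\xi(f)_\sigma$. $\mathcal{C}\leq_{\mathrm{m}}\mathcal{D}$ means there is a minion homomorphism $\mathcal{C}\to\mathcal{D}$, and $\equiv_{\mathrm{m}}$ means $\leq_{\mathrm{m}}$ in both directions. Relations: $\mu_2$ is the equivalence relation on $\{0,1,2\}$ with classes $\{0,1\},\{2\}$; $\rho_2=\{0,1,2\}^2\setminus\mu_2$; $\psi_2=\{(0,1),(1,0),(2,2)\}$. Structures/clones: $\mathbb{M}_1=(\{0,1,2\};\psi_2,\mu_2,\{0\},\{1\},\{2\})$; $\mathbb{M}_0=(\{0,1,2\};\psi_2,\rho_2,\{0,1\},\{0\},\{1\},\{2\})$; $\mathcal{C}_2=\mathrm{Pol}(\{0,1\};\neq,\{0\},\{1\})$; $\mathcal{I}_2=\mathrm{Pol}(\{0,1\};\{0\},\{1\})$. *)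

theory Defs
  imports Main
begin

text \<open>Operations on a finite domain A (carrier type nat). An n-ary operation is
  represented by a function on lists, extensional: undefined outside lists over A of
  length n. A clone/minion is a set of pairs (arity, operation), arities >= 1.\<close>

definition valid_args :: "nat set \<Rightarrow> nat \<Rightarrow> nat list \<Rightarrow> bool" where
  "valid_args A n xs \<longleftrightarrow> xs \<in> lists A \<and> length xs = n"

definition ops :: "nat set \<Rightarrow> nat \<Rightarrow> (nat list \<Rightarrow> nat) set" where
  "ops A n = {f. (\<forall>xs. valid_args A n xs \<longrightarrow> f xs \<in> A)
                 \<and> (\<forall>xs. \<not> valid_args A n xs \<longrightarrow> f xs = undefined)}"

definition proj :: "nat set \<Rightarrow> nat \<Rightarrow> nat \<Rightarrow> (nat list \<Rightarrow> nat)" where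
  "proj A n i = (\<lambda>xs. if valid_args A n xs then xs ! i else undefined)"

definition compose :: "nat set \<Rightarrow> nat \<Rightarrow> (nat list \<Rightarrow> nat) \<Rightarrow> (nat list \<Rightarrow> nat) list
    \<Rightarrow> (nat list \<Rightarrow> nat)" where
  "compose A m f gs = (\<lambda>xs. if valid_args A m xs then f (map (\<lambda>g. g xs) gs) else undefined)"

definition is_clone :: "nat set \<Rightarrow> (nat \<times> (nat list \<Rightarrow> nat)) set \<Rightarrow> bool" where
  "is_clone A C \<longleftrightarrow>
     (\<forall>(n, f) \<in> C. n \<ge> 1 \<and> f \<in> ops A n)
   \<and> (\<forall>n i. 1 \<le> n \<and> i < n \<longrightarrow> (n, proj A n i) \<in> C)
   \<and> (\<forall>(n, f) \<in> C. \<forall>m gs. 1 \<le> m \<and> length gs = n \<and> (\<forall>g \<in> set gs. (m, g) \<in> C)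
          \<longrightarrow> (m, compose A m f gs) \<in> C)"

definition preserves_op :: "(nat list \<Rightarrow> nat) \<Rightarrow> nat \<Rightarrow> nat list set \<Rightarrow> bool" where
  "preserves_op f n R \<longleftrightarrow>
     (\<forall>ts k. length ts = n \<and> set ts \<subseteq> R \<and> (\<forall>t \<in> set ts. length t = k)
        \<longrightarrow> map (\<lambda>j. f (map (\<lambda>t. t ! j) ts)) [0..<k] \<in> R)"

definition clone_preserves :: "(nat \<times> (nat list \<Rightarrow> nat)) set \<Rightarrow> nat list set \<Rightarrow> bool" where
  "clone_preserves C R \<longleftrightarrow> (\<forall>(n, f) \<in> C. preserves_op f n R)"

definition Pol :: "nat set \<Rightarrow> nat list set set \<Rightarrow> (nat \<times> (nat list \<Rightarrow> nat)) set" where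
  "Pol A \<Gamma> = {(n, f). n \<ge> 1 \<and> f \<in> ops A n \<and> (\<forall>R \<in> \<Gamma>. preserves_op f n R)}"

definition idempotent_clone :: "nat set \<Rightarrow> (nat \<times> (nat list \<Rightarrow> nat)) set \<Rightarrow> bool" where
  "idempotent_clone A C \<longleftrightarrow> (\<forall>(n, f) \<in> C. \<forall>x \<in> A. f (replicate n x) = x)"

definition malcev_clone :: "nat set \<Rightarrow> (nat \<times> (nat list \<Rightarrow> nat)) set \<Rightarrow> bool" where
  "malcev_clone A C \<longleftrightarrow> (\<exists>d. (3, d) \<in> C \<and> (\<forall>x \<in> A. \<forall>y \<in> A. d [y, x, x] = y \<and> d [x, x, y] = y))"

definition has_majority :: "nat set \<Rightarrow> (nat \<times> (nat list \<Rightarrow> nat)) set \<Rightarrow> bool" where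
  "has_majority A C \<longleftrightarrow> (\<exists>m. (3, m) \<in> C \<and> (\<forall>x \<in> A. \<forall>y \<in> A.
       m [x, y, y] = y \<and> m [y, x, y] = y \<and> m [y, y, x] = y))"

definition minor :: "nat set \<Rightarrow> nat \<Rightarrow> (nat list \<Rightarrow> nat) \<Rightarrow> nat \<Rightarrow> (nat \<Rightarrow> nat)
    \<Rightarrow> (nat list \<Rightarrow> nat)" where
  "minor A n f r \<sigma> = (\<lambda>xs. if valid_args A r xs then f (map (\<lambda>i. xs ! \<sigma> i) [0..<n]) else undefined)"

definition minion_hom :: "nat set \<Rightarrow> (nat \<times> (nat list \<Rightarrow> nat)) set \<Rightarrow> nat set
    \<Rightarrow> (nat \<times> (nat list \<Rightarrow> nat)) set \<Rightarrow> (nat \<Rightarrow> (nat list \<Rightarrow> nat) \<Rightarrow> (nat list \<Rightarrow> nat)) \<Rightarrow> bool" where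
  "minion_hom A C B D \<xi> \<longleftrightarrow>
     (\<forall>(n, f) \<in> C. (n, \<xi> n f) \<in> D)
   \<and> (\<forall>(n, f) \<in> C. \<forall>r \<sigma>. 1 \<le> r \<and> \<sigma> ` {..<n} \<subseteq> {..<r}
        \<longrightarrow> \<xi> r (minor A n f r \<sigma>) = minor B n (\<xi> n f) r \<sigma>)"

definition minion_le :: "nat set \<Rightarrow> (nat \<times> (nat list \<Rightarrow> nat)) set \<Rightarrow> nat set
    \<Rightarrow> (nat \<times> (nat list \<Rightarrow> nat)) set \<Rightarrow> bool" where
  "minion_le A C B D \<longleftrightarrow> (\<exists>\<xi>. minion_hom A C B D \<xi>)"

definition minion_eq :: "nat set \<Rightarrow> (nat \<times> (nat list \<Rightarrow> nat)) set \<Rightarrow> nat set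
    \<Rightarrow> (nat \<times> (nat list \<Rightarrow> nat)) set \<Rightarrow> bool" where
  "minion_eq A C B D \<longleftrightarrow> minion_le A C B D \<and> minion_le B D A C"

definition D3 :: "nat set" where "D3 = {0, 1, 2}"
definition D2 :: "nat set" where "D2 = {0, 1}"

definition mu2 :: "nat list set" where
  "mu2 = {[x, y] | x y. x \<in> D3 \<and> y \<in> D3 \<and> (x = y \<or> (x \<in> {0,1} \<and> y \<in> {0,1}))}"
definition rho2 :: "nat list set" where
  "rho2 = {[x, y] | x y. x \<in> D3 \<and> y \<in> D3} - mu2"
definition psi2 :: "nat list set" where
  "psi2 = {[0, 1], [1, 0], [2, 2]}"
definition neq2 :: "nat list set" where
  "neq2 = {[0, 1], [1, 0]}"

definition PolM1 where "PolM1 = Pol D3 {psi2, mu2, {[0]}, {[1]}, {[2]}}"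
definition PolM0 where "PolM0 = Pol D3 {psi2, rho2, {[0], [1]}, {[0]}, {[1]}, {[2]}}"
definition C2 where "C2 = Pol D2 {neq2, {[0]}, {[1]}}"
definition I2 where "I2 = Pol D2 {{[0]}, {[1]}}"

end

theory Submission
  imports Defs
begin

text \<open>By Baker--Pixley, a clone with a majority operation is determined by its binary invariant
  relations. The Mal'cev operation makes these rectangular, and so do compositions with \<open>\<mu>\<^sub>2\<close>; on
  three elements this leaves, up to restriction to subuniverses, only equality, \<open>\<mu>\<^sub>2\<close>, \<open>\<rho>\<^sub>2\<close>, \<open>\<psi>\<^sub>2\<close>,
  disequality on \<open>{0, 1}\<close>, and the isomorphisms between \<open>{0, 1}\<close> and the quotient by \<open>\<mu>\<^sub>2\<close>.

  Homomorphisms out of the clone are inclusions, the restriction to \<open>{0, 1}\<close>, or the quotient by \<open>\<mu>\<^sub>2\<close>.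
  A homomorphism into it sends \<open>f\<close> to the operation whose value at \<open>x\<close> depends only on the ternary minor
  of \<open>f\<close> that identifies variables according to \<open>x\<close>. Such a map automatically commutes with minors, and
  by looking at which variables the ternary minor depends on one makes its values conservative, so
  that only the few relations above remain to be checked.\<close>

section \<open>Rectangular relations on three elements\<close>

text \<open>Predicates replace the sets of lists so that \<open>OO\<close>, converse and
  \<open>list_all2\<close> apply directly.\<close>

definition mu :: "nat \<Rightarrow> nat \<Rightarrow> bool" where
  "mu a b \<longleftrightarrow> a \<in> D3 \<and> b \<in> D3 \<and> (a = 2 \<longleftrightarrow> b = 2)"
definition rho :: "nat \<Rightarrow> nat \<Rightarrow> bool" where
  "rho a b \<longleftrightarrow> a \<in> D3 \<and> b \<in> D3 \<and> (a = 2 \<longleftrightarrow> b \<noteq> 2)"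
definition psi :: "nat \<Rightarrow> nat \<Rightarrow> bool" where
  "psi a b \<longleftrightarrow> a = 0 \<and> b = 1 \<or> a = 1 \<and> b = 0 \<or> a = 2 \<and> b = 2"
definition neq :: "nat \<Rightarrow> nat \<Rightarrow> bool" where
  "neq a b \<longleftrightarrow> a = 0 \<and> b = 1 \<or> a = 1 \<and> b = 0"

text \<open>\<open>iso e\<close> is the graph of the isomorphism from \<open>{0, 1}\<close> onto the quotient by \<open>mu\<close> that sends
  \<open>e\<close> to the class \<open>{0, 1}\<close>.\<close>

definition iso :: "nat \<Rightarrow> nat \<Rightarrow> nat \<Rightarrow> bool" where
  "iso e a b \<longleftrightarrow> a \<in> D2 \<and> b \<in> D3 \<and> (b = 2 \<longleftrightarrow> a \<noteq> e)"

definition bounded :: "(nat \<Rightarrow> nat \<Rightarrow> bool) \<Rightarrow> bool" where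
  "bounded r \<longleftrightarrow> (\<forall>a b. r a b \<longrightarrow> a \<in> D3 \<and> b \<in> D3)"

text \<open>Also called difunctional: the parallelogram property that a Mal'cev operation forces on
  its invariant relations.\<close>

definition rectangular :: "(nat \<Rightarrow> nat \<Rightarrow> bool) \<Rightarrow> bool" where
  "rectangular r \<longleftrightarrow> (\<forall>a\<in>D3. \<forall>b\<in>D3. \<forall>a'\<in>D3. \<forall>b'\<in>D3. r a b \<longrightarrow> r a b' \<longrightarrow> r a' b' \<longrightarrow> r a' b)"

text \<open>The relation is \<open>B\<close> restricted to the product of the two projections of
  \<open>r\<close>. A conservative operation respects the projections by itself, so only
  \<open>B\<close> needs testing.\<close>

definition cut_by :: "(nat \<Rightarrow> nat \<Rightarrow> bool) \<Rightarrow> (nat \<Rightarrow> nat \<Rightarrow> bool) \<Rightarrow> bool" where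
  "cut_by r B \<longleftrightarrow> (\<forall>a\<in>D3. \<forall>b\<in>D3. r a b \<longleftrightarrow> (\<exists>y\<in>D3. r a y) \<and> (\<exists>x\<in>D3. r x b) \<and> B a b)"

lemma OO_mu: "bounded r \<Longrightarrow> (r OO mu) = (\<lambda>a b. b \<in> D3 \<and> (if b = 2 then r a 2 else r a 0 \<or> r a 1))"
  by (fastforce simp: fun_eq_iff relcompp.simps mu_def bounded_def D3_def)

lemma mu_OO: "bounded r \<Longrightarrow> (mu OO r) = (\<lambda>a b. a \<in> D3 \<and> (if a = 2 then r 2 b else r 0 b \<or> r 1 b))"
  by (fastforce simp: fun_eq_iff relcompp.simps mu_def bounded_def D3_def)

lemma bounded_mu: "bounded mu" and bounded_rho: "bounded rho" and bounded_psi: "bounded psi"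
  and bounded_neq: "bounded neq" and bounded_iso: "bounded (iso e)"
  by (auto simp: bounded_def mu_def rho_def psi_def neq_def iso_def D3_def D2_def)

lemma bounded_OO: "bounded r \<Longrightarrow> bounded s \<Longrightarrow> bounded (r OO s)"
  by (auto simp: bounded_def)

lemma bounded_conv: "bounded r \<Longrightarrow> bounded (r\<inverse>\<inverse>)"
  by (auto simp: bounded_def)

lemma mu_OO_mu:
  assumes "bounded r"
  shows "(mu OO r OO mu) = (\<lambda>a b. a \<in> D3 \<and> b \<in> D3 \<and>
    (if a = 2 then if b = 2 then r 2 2 else r 2 0 \<or> r 2 1
     else if b = 2 then r 0 2 \<or> r 1 2 else r 0 0 \<or> r 0 1 \<or> r 1 0 \<or> r 1 1))"
  unfolding mu_OO[OF bounded_OO[OF assms bounded_mu]]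
  by (auto simp: OO_mu[OF assms] fun_eq_iff D3_def)

lemma bounded_eqI: "bounded r \<Longrightarrow> bounded s \<Longrightarrow> \<forall>a\<in>D3. \<forall>b\<in>D3. r a b = s a b \<Longrightarrow> r = s"
  unfolding bounded_def fun_eq_iff by blast

text \<open>Rectangularity of the 2 by 2 submatrix with rows \<open>a b\<close> and
  \<open>c d\<close>: exactly three true entries are forbidden.\<close>

definition rect2 :: "bool \<Rightarrow> bool \<Rightarrow> bool \<Rightarrow> bool \<Rightarrow> bool" where
  "rect2 a b c d \<longleftrightarrow> (a \<and> b \<and> c \<longrightarrow> d) \<and> (a \<and> b \<and> d \<longrightarrow> c) \<and> (a \<and> c \<and> d \<longrightarrow> b) \<and> (b \<and> c \<and> d \<longrightarrow> a)"

definition cut_matrix where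
  "cut_matrix r00 r01 r02 r10 r11 r12 r20 r21 r22 b00 b01 b02 b10 b11 b12 b20 b21 b22 \<longleftrightarrow>
  r00 = ((r00 \<or> r01 \<or> r02) \<and> (r00 \<or> r10 \<or> r20) \<and> b00) \<and>
  r01 = ((r00 \<or> r01 \<or> r02) \<and> (r01 \<or> r11 \<or> r21) \<and> b01) \<and>
  r02 = ((r00 \<or> r01 \<or> r02) \<and> (r02 \<or> r12 \<or> r22) \<and> b02) \<and>
  r10 = ((r10 \<or> r11 \<or> r12) \<and> (r00 \<or> r10 \<or> r20) \<and> b10) \<and>
  r11 = ((r10 \<or> r11 \<or> r12) \<and> (r01 \<or> r11 \<or> r21) \<and> b11) \<and>
  r12 = ((r10 \<or> r11 \<or> r12) \<and> (r02 \<or> r12 \<or> r22) \<and> b12) \<and>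
  r20 = ((r20 \<or> r21 \<or> r22) \<and> (r00 \<or> r10 \<or> r20) \<and> b20) \<and>
  r21 = ((r20 \<or> r21 \<or> r22) \<and> (r01 \<or> r11 \<or> r21) \<and> b21) \<and>
  r22 = ((r20 \<or> r21 \<or> r22) \<and> (r02 \<or> r12 \<or> r22) \<and> b22)"

text \<open>Nine conditions for the relation itself, three for each one-sided composition with \<open>mu\<close>, and one
  for the two-sided composition.\<close>

definition rectangular_matrix where
  "rectangular_matrix r00 r01 r02 r10 r11 r12 r20 r21 r22 \<longleftrightarrow>
   rect2 r00 r01 r10 r11 \<and> rect2 r00 r02 r10 r12 \<and> rect2 r01 r02 r11 r12 \<and>
   rect2 r00 r01 r20 r21 \<and> rect2 r00 r02 r20 r22 \<and> rect2 r01 r02 r21 r22 \<and>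
   rect2 r20 r21 r10 r11 \<and> rect2 r20 r22 r10 r12 \<and> rect2 r21 r22 r11 r12 \<and>
   rect2 (r00 \<or> r01) r02 (r10 \<or> r11) r12 \<and>
   rect2 (r00 \<or> r01) r02 (r20 \<or> r21) r22 \<and>
   rect2 (r10 \<or> r11) r12 (r20 \<or> r21) r22 \<and>
   rect2 (r00 \<or> r10) (r01 \<or> r11) r20 r21 \<and>
   rect2 (r00 \<or> r10) (r02 \<or> r12) r20 r22 \<and>
   rect2 (r01 \<or> r11) (r02 \<or> r12) r21 r22 \<and>
   rect2 (r00 \<or> r01 \<or> r10 \<or> r11) (r02 \<or> r12) (r20 \<or> r21) r22"

text \<open>The last six disjuncts describe relations that are cut out by \<open>rho\<close>, by \<open>psi\<close> or \<open>neq\<close>, and by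
  the four relations \<open>iso e\<close> and their converses.\<close>

definition matrix_shape where
  "matrix_shape r00 r01 r02 r10 r11 r12 r20 r21 r22 \<longleftrightarrow>
  cut_matrix r00 r01 r02 r10 r11 r12 r20 r21 r22 True True True True True True True True True \<or>
  cut_matrix r00 r01 r02 r10 r11 r12 r20 r21 r22 True False False False True False False False True \<or>
  cut_matrix r00 r01 r02 r10 r11 r12 r20 r21 r22 True True False True True False False False True \<or>
  (\<not> (r00 \<or> r01 \<or> r10 \<or> r11) \<and> (r02 \<or> r12) \<and> (r20 \<or> r21) \<and> \<not> r22) \<or>
  (\<not> r00 \<and> r01 \<and> \<not> r02 \<and> r10 \<and> \<not> r11 \<and> \<not> r12 \<and> \<not> r20 \<and> \<not> r21) \<or>
  (\<not> (r20 \<or> r21 \<or> r22) \<and> (r00 \<or> r01) \<and> r12 \<and> \<not> r02 \<and> \<not> (r10 \<or> r11)) \<or>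
  (\<not> (r20 \<or> r21 \<or> r22) \<and> (r10 \<or> r11) \<and> r02 \<and> \<not> r12 \<and> \<not> (r00 \<or> r01)) \<or>
  (\<not> (r02 \<or> r12 \<or> r22) \<and> (r00 \<or> r10) \<and> r21 \<and> \<not> r20 \<and> \<not> (r01 \<or> r11)) \<or>
  (\<not> (r02 \<or> r12 \<or> r22) \<and> (r01 \<or> r11) \<and> r20 \<and> \<not> r21 \<and> \<not> (r00 \<or> r10))"

text \<open>There are only 512 Boolean matrices of size 3 by 3; closing the statement under all nine
  entries lets \<open>all_bool_eq\<close> expand it into a finite check.\<close>

lemma rectangular_matrix_shape:
  assumes "rectangular_matrix r00 r01 r02 r10 r11 r12 r20 r21 r22"
  shows "matrix_shape r00 r01 r02 r10 r11 r12 r20 r21 r22"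
proof -
  have "\<forall>r00 r01 r02 r10 r11 r12 r20 r21 r22. rectangular_matrix r00 r01 r02 r10 r11 r12 r20 r21 r22
    \<longrightarrow> matrix_shape r00 r01 r02 r10 r11 r12 r20 r21 r22"
    unfolding all_bool_eq
    by (simp add: rectangular_matrix_def rect2_def matrix_shape_def cut_matrix_def)
  then show ?thesis using assms by blast
qed

lemma D3_mem [simp]: "0 \<in> D3" "1 \<in> D3" "2 \<in> D3" "Suc 0 \<in> D3"
  by (auto simp: D3_def)

lemma rectangular_rect2:
  "rectangular r \<Longrightarrow> a \<in> D3 \<Longrightarrow> b \<in> D3 \<Longrightarrow> a' \<in> D3 \<Longrightarrow> b' \<in> D3 \<Longrightarrow> rect2 (r a b) (r a b') (r a' b) (r a' b')"
  unfolding rectangular_def rect2_def by blast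

lemma cut_byI: "cut_matrix (r 0 0) (r 0 1) (r 0 2) (r 1 0) (r 1 1) (r 1 2) (r 2 0) (r 2 1) (r 2 2)
  (B 0 0) (B 0 1) (B 0 2) (B 1 0) (B 1 1) (B 1 2) (B 2 0) (B 2 1) (B 2 2) \<Longrightarrow> cut_by r B"
  by (simp add: cut_by_def cut_matrix_def D3_def)

text \<open>In the second alternative \<open>B\<close> is moreover obtained from \<open>r\<close> by
  composing with \<open>mu\<close>, so a clone that preserves \<open>r\<close> and \<open>mu\<close>
  also preserves \<open>B\<close>.\<close>

lemma rectangular_cases:
  assumes b: "bounded r" and "rectangular r" "rectangular (r OO mu)" "rectangular (mu OO r)"
    "rectangular (mu OO r OO mu)"
  shows "(\<exists>B \<in> {\<lambda>_ _. True, (=), mu}. cut_by r B) \<or>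
    (\<exists>B \<in> {rho, psi, neq, iso 0, iso 1, (iso 0)\<inverse>\<inverse>, (iso 1)\<inverse>\<inverse>}.
      B \<in> {r, r OO mu, mu OO r, mu OO r OO mu} \<and> cut_by r B)" (is "?P \<or> ?Q")
proof -
  note OO = OO_mu[OF b] mu_OO[OF b] and OO3 = mu_OO_mu[OF b]
  note bd = b bounded_OO bounded_mu bounded_conv bounded_rho bounded_psi bounded_neq bounded_iso
  note m = rectangular_rect2[OF assms(2)] and m1 = rectangular_rect2[OF assms(3)]
    and m2 = rectangular_rect2[OF assms(4)] and m3 = rectangular_rect2[OF assms(5)]
  have "rectangular_matrix (r 0 0) (r 0 1) (r 0 2) (r 1 0) (r 1 1) (r 1 2) (r 2 0) (r 2 1) (r 2 2)"
    using m[of 0 0 1 1] m[of 0 0 1 2] m[of 0 1 1 2] m[of 0 0 2 1] m[of 0 0 2 2] m[of 0 1 2 2]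
     m[of 2 0 1 1] m[of 2 0 1 2] m[of 2 1 1 2] m1[of 0 0 1 2] m1[of 0 0 2 2] m1[of 1 0 2 2]
     m2[of 0 0 2 1] m2[of 0 0 2 2] m2[of 0 1 2 2] m3[of 0 0 2 2, unfolded OO3]
    by (simp add: rectangular_matrix_def OO disj_assoc)
  then have "matrix_shape (r 0 0) (r 0 1) (r 0 2) (r 1 0) (r 1 1) (r 1 2) (r 2 0) (r 2 1) (r 2 2)"
    by (rule rectangular_matrix_shape)
  then show ?thesis
    unfolding matrix_shape_def
  proof (elim disjE)
    assume "cut_matrix (r 0 0) (r 0 1) (r 0 2) (r 1 0) (r 1 1) (r 1 2) (r 2 0) (r 2 1) (r 2 2)
      True True True True True True True True True"
    then have "cut_by r (\<lambda>_ _. True)" by (intro cut_byI) (simp add: mu_def)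
    then show ?thesis by simp
  next
    assume "cut_matrix (r 0 0) (r 0 1) (r 0 2) (r 1 0) (r 1 1) (r 1 2) (r 2 0) (r 2 1) (r 2 2)
      True False False False True False False False True"
    then have "cut_by r (=)" by (intro cut_byI) (simp add: mu_def)
    then show ?thesis by simp
  next
    assume "cut_matrix (r 0 0) (r 0 1) (r 0 2) (r 1 0) (r 1 1) (r 1 2) (r 2 0) (r 2 1) (r 2 2)
      True True False True True False False False True"
    then have "cut_by r mu" by (intro cut_byI) (simp add: mu_def)
    then show ?thesis by simp
  next
    \<comment> \<open>Elements of equal class are never related, so merging 0 and 1 on both sides
      leaves exactly \<open>rho\<close>.\<close>
    assume 2: "\<not> (r 0 0 \<or> r 0 1 \<or> r 1 0 \<or> r 1 1) \<and> (r 0 2 \<or> r 1 2) \<and> (r 2 0 \<or> r 2 1) \<and> \<not> r 2 2"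
    then have "cut_by r rho" by (intro cut_byI) (simp add: cut_matrix_def rho_def D3_def)
    moreover have "mu OO r OO mu = rho"
      by (intro bounded_eqI bd) (use 2 in \<open>simp add: OO3 rho_def iso_def D3_def D2_def\<close>)
    ultimately show ?thesis by (intro disjI2 bexI[of _ rho]) simp_all
  next
    assume 3: "\<not> r 0 0 \<and> r 0 1 \<and> \<not> r 0 2 \<and> r 1 0 \<and> \<not> r 1 1 \<and> \<not> r 1 2 \<and> \<not> r 2 0 \<and> \<not> r 2 1"
    show ?thesis
    proof (cases "r 2 2")
      case True
      then have "r = psi"
        by (intro bounded_eqI bd) (use 3 in \<open>simp add: psi_def D3_def\<close>)
      moreover have "cut_by psi psi" by (auto simp: cut_by_def psi_def D3_def)
      ultimately show ?thesis by (intro disjI2 bexI[of _ psi]) simp_all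
    next
      case False
      then have "r = neq"
        by (intro bounded_eqI bd) (use 3 in \<open>simp add: neq_def D3_def\<close>)
      moreover have "cut_by neq neq" by (auto simp: cut_by_def neq_def D3_def)
      ultimately show ?thesis by (intro disjI2 bexI[of _ neq]) simp_all
    qed
  next
    \<comment> \<open>Row 2 is empty, and rows 0 and 1 meet different classes of columns. Composing
      with \<open>mu\<close> on the right completes these classes. The next case swaps the two rows;
      the last two cases are the transposes.\<close>
    assume 4: "\<not> (r 2 0 \<or> r 2 1 \<or> r 2 2) \<and> (r 0 0 \<or> r 0 1) \<and> r 1 2 \<and> \<not> r 0 2 \<and> \<not> (r 1 0 \<or> r 1 1)"
    then have "cut_by r (iso 0)" by (intro cut_byI) (simp add: cut_matrix_def iso_def D3_def D2_def)
    moreover have "r OO mu = iso 0"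
      by (intro bounded_eqI bd) (use 4 in \<open>simp add: OO rho_def iso_def D3_def D2_def\<close>)
    ultimately show ?thesis by (intro disjI2 bexI[of _ "iso 0"]) simp_all
  next
    assume 5: "\<not> (r 2 0 \<or> r 2 1 \<or> r 2 2) \<and> (r 1 0 \<or> r 1 1) \<and> r 0 2 \<and> \<not> r 1 2 \<and> \<not> (r 0 0 \<or> r 0 1)"
    then have "cut_by r (iso 1)" by (intro cut_byI) (simp add: cut_matrix_def iso_def D3_def D2_def)
    moreover have "r OO mu = iso 1"
      by (intro bounded_eqI bd) (use 5 in \<open>simp add: OO rho_def iso_def D3_def D2_def\<close>)
    ultimately show ?thesis by (intro disjI2 bexI[of _ "iso 1"]) simp_all
  next
    assume 6: "\<not> (r 0 2 \<or> r 1 2 \<or> r 2 2) \<and> (r 0 0 \<or> r 1 0) \<and> r 2 1 \<and> \<not> r 2 0 \<and> \<not> (r 0 1 \<or> r 1 1)"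
    then have "cut_by r ((iso 0)\<inverse>\<inverse>)" by (intro cut_byI) (simp add: cut_matrix_def iso_def D3_def D2_def)
    moreover have "mu OO r = (iso 0)\<inverse>\<inverse>"
      by (intro bounded_eqI bd) (use 6 in \<open>simp add: OO rho_def iso_def D3_def D2_def\<close>)
    ultimately show ?thesis by (intro disjI2 bexI[of _ "(iso 0)\<inverse>\<inverse>"]) simp_all
  next
    assume 7: "\<not> (r 0 2 \<or> r 1 2 \<or> r 2 2) \<and> (r 0 1 \<or> r 1 1) \<and> r 2 0 \<and> \<not> r 2 1 \<and> \<not> (r 0 0 \<or> r 1 0)"
    then have "cut_by r ((iso 1)\<inverse>\<inverse>)" by (intro cut_byI) (simp add: cut_matrix_def iso_def D3_def D2_def)
    moreover have "mu OO r = (iso 1)\<inverse>\<inverse>"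
      by (intro bounded_eqI bd) (use 7 in \<open>simp add: OO rho_def iso_def D3_def D2_def\<close>)
    ultimately show ?thesis by (intro disjI2 bexI[of _ "(iso 1)\<inverse>\<inverse>"]) simp_all
  qed
qed

section \<open>Preservation and the Baker--Pixley theorem\<close>

text \<open>The arguments are the two coordinate lists of a list of pairs, so closure under
  composition and converse follows from the relator laws of \<open>list_all2\<close>.\<close>

definition pres :: "nat \<Rightarrow> (nat list \<Rightarrow> nat) \<Rightarrow> (nat \<Rightarrow> nat \<Rightarrow> bool) \<Rightarrow> bool" where
  "pres n f r \<longleftrightarrow> (\<forall>xs ys. length xs = n \<longrightarrow> list_all2 r xs ys \<longrightarrow> r (f xs) (f ys))"

lemma presD: "pres n f r \<Longrightarrow> length xs = n \<Longrightarrow> list_all2 r xs ys \<Longrightarrow> r (f xs) (f ys)"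
  by (simp add: pres_def)

lemma pres_OO:
  assumes "pres n f r" "pres n f s"
  shows "pres n f (r OO s)"
  unfolding pres_def
proof (intro allI impI)
  fix xs ys assume l: "length xs = n" and "list_all2 (r OO s) xs ys"
  then obtain zs where zs: "list_all2 r xs zs" "list_all2 s zs ys"
    by (auto simp: list.rel_compp)
  then have "length zs = n" using l by (auto dest: list_all2_lengthD)
  then show "(r OO s) (f xs) (f ys)" using zs l presD[OF assms(1)] presD[OF assms(2)] by blast
qed

lemma pres_conv:
  assumes "pres n f r"
  shows "pres n f (r\<inverse>\<inverse>)"
  unfolding pres_def list.rel_conversep using presD[OF assms] by (auto dest: list_all2_lengthD)

lemma preserves_op_binary:
  assumes "n \<ge> 1"
  shows "preserves_op f n {[a, b] | a b. r a b} \<longleftrightarrow> pres n f r"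
proof
  assume p: "preserves_op f n {[a, b] | a b. r a b}"
  show "pres n f r"
    unfolding pres_def
  proof (intro allI impI)
    fix xs ys assume l: "length xs = n" and a: "list_all2 r xs ys"
    define ts where "ts = map (\<lambda>(a, b). [a, b]) (zip xs ys)"
    have ly: "length ys = n" using l a by (simp add: list_all2_lengthD)
    have "length ts = n" "set ts \<subseteq> {[a, b] | a b. r a b}" "\<forall>t\<in>set ts. length t = 2"
      using a l ly by (auto simp: ts_def list_all2_iff)
    then have "map (\<lambda>j. f (map (\<lambda>t. t ! j) ts)) [0..<2] \<in> {[a, b] | a b. r a b}"
      using p unfolding preserves_op_def by blast
    moreover have "map (\<lambda>t. t ! 0) ts = xs" "map (\<lambda>t. t ! 1) ts = ys"
      using l ly by (auto simp: ts_def intro!: nth_equalityI)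
    ultimately show "r (f xs) (f ys)" by (simp add: upt_conv_Cons numeral_2_eq_2)
  qed
next
  assume p: "pres n f r"
  show "preserves_op f n {[a, b] | a b. r a b}"
    unfolding preserves_op_def
  proof (intro allI impI, elim conjE)
    fix ts k assume l: "length ts = n" and s: "set ts \<subseteq> {[a, b] | a b. r a b}"
      and k: "\<forall>t\<in>set ts. length t = k"
    \<comment> \<open>Positive arity provides a tuple, and its membership in the relation fixes the
      length \<open>k\<close>.\<close>
    have "ts \<noteq> []" using l assms by auto
    then have k2: "k = 2" using s k by (cases ts) auto
    have "list_all2 r (map (\<lambda>t. t ! 0) ts) (map (\<lambda>t. t ! 1) ts)"
      unfolding list.rel_map using s by (intro list.rel_refl_strong) auto
    then have "r (f (map (\<lambda>t. t ! 0) ts)) (f (map (\<lambda>t. t ! 1) ts))"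
      using p l by (simp add: pres_def)
    then show "map (\<lambda>j. f (map (\<lambda>t. t ! j) ts)) [0..<k] \<in> {[a, b] | a b. r a b}"
      by (simp add: k2 upt_conv_Cons numeral_2_eq_2)
  qed
qed

lemma preserves_op_unary:
  assumes "n \<ge> 1"
  shows "preserves_op f n {[a] | a. P a} \<longleftrightarrow> (\<forall>xs. length xs = n \<longrightarrow> (\<forall>x\<in>set xs. P x) \<longrightarrow> P (f xs))"
proof
  assume p: "preserves_op f n {[a] | a. P a}"
  show "\<forall>xs. length xs = n \<longrightarrow> (\<forall>x\<in>set xs. P x) \<longrightarrow> P (f xs)"
  proof (intro allI impI)
    fix xs assume l: "length xs = n" and a: "\<forall>x\<in>set xs. P x"
    define ts where "ts = map (\<lambda>a. [a]) xs"
    have "length ts = n" "set ts \<subseteq> {[a] | a. P a}" "\<forall>t\<in>set ts. length t = 1"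
      using a l by (auto simp: ts_def)
    then have "map (\<lambda>j. f (map (\<lambda>t. t ! j) ts)) [0..<1] \<in> {[a] | a. P a}"
      using p unfolding preserves_op_def by blast
    moreover have "map (\<lambda>t. t ! 0) ts = xs"
      by (auto simp: ts_def intro!: nth_equalityI)
    ultimately show "P (f xs)" by (simp add: upt_rec)
  qed
next
  assume p: "\<forall>xs. length xs = n \<longrightarrow> (\<forall>x\<in>set xs. P x) \<longrightarrow> P (f xs)"
  show "preserves_op f n {[a] | a. P a}"
    unfolding preserves_op_def
  proof (intro allI impI, elim conjE)
    fix ts k assume l: "length ts = n" and s: "set ts \<subseteq> {[a] | a. P a}"
      and k: "\<forall>t\<in>set ts. length t = k"
    have "ts \<noteq> []" using l assms by auto
    then have k2: "k = 1" using s k by (cases ts) auto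
    have "\<forall>x\<in>set (map (\<lambda>t. t ! 0) ts). P x"
      using s by auto
    then have "P (f (map (\<lambda>t. t ! 0) ts))"
      using p l by simp
    then show "map (\<lambda>j. f (map (\<lambda>t. t ! j) ts)) [0..<k] \<in> {[a] | a. P a}"
      by (simp add: k2 upt_rec)
  qed
qed

lemma preserves_op_singleton:
  assumes "n \<ge> 1"
  shows "preserves_op f n {[c]} \<longleftrightarrow> f (replicate n c) = c"
proof -
  have "{[a] | a. a = c} = {[c]}" by simp
  moreover have "length xs = n \<and> (\<forall>x\<in>set xs. x = c) \<longleftrightarrow> xs = replicate n c" for xs
    using replicate_eqI[of xs n c] by auto
  ultimately show ?thesis
    using preserves_op_unary[OF assms, of f "\<lambda>a. a = c"] by metis
qed

lemma mu2_eq: "mu2 = {[a, b] | a b. mu a b}" and rho2_eq: "rho2 = {[a, b] | a b. rho a b}"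
  and psi2_eq: "psi2 = {[a, b] | a b. psi a b}" and neq2_eq: "neq2 = {[a, b] | a b. neq a b}"
  by (auto simp: mu2_def rho2_def psi2_def neq2_def mu_def rho_def psi_def neq_def D3_def)

lemmas preserves_op_rels = preserves_op_binary[of _ _ mu, folded mu2_eq]
  preserves_op_binary[of _ _ rho, folded rho2_eq] preserves_op_binary[of _ _ psi, folded psi2_eq]
  preserves_op_binary[of _ _ neq, folded neq2_eq]

section \<open>Closure properties of clones and Baker--Pixley interpolation\<close>

lemma clone_arity: "is_clone A C \<Longrightarrow> (n, f) \<in> C \<Longrightarrow> n \<ge> 1"
  and clone_ops: "is_clone A C \<Longrightarrow> (n, f) \<in> C \<Longrightarrow> f \<in> ops A n"
  unfolding is_clone_def by (drule conjunct1; blast)+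

lemma clone_proj: "is_clone A C \<Longrightarrow> i < n \<Longrightarrow> (n, proj A n i) \<in> C"
  unfolding is_clone_def by (drule conjunct2, drule conjunct1) auto

lemma clone_compose:
  assumes "is_clone A C" "(n, f) \<in> C" "1 \<le> m" "length gs = n" "\<forall>g \<in> set gs. (m, g) \<in> C"
  shows "(m, compose A m f gs) \<in> C"
proof -
  have "\<forall>(n, f) \<in> C. \<forall>m gs. 1 \<le> m \<and> length gs = n \<and> (\<forall>g \<in> set gs. (m, g) \<in> C)
    \<longrightarrow> (m, compose A m f gs) \<in> C"
    using assms(1) unfolding is_clone_def by (elim conjE)
  then show ?thesis using assms(2-) by blast
qed

lemma finite_valid_args: "finite A \<Longrightarrow> finite {xs. valid_args A n xs}"
  using finite_lists_length_eq[of A n] by (simp add: valid_args_def lists_eq_set)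

text \<open>Induction on the size of \<open>S\<close>. If \<open>S\<close> has three distinct
  points, interpolants that each omit one of them are combined by the majority operation.\<close>

lemma clone_agree_on:
  assumes cl: "is_clone A C" and maj: "has_majority A C" and n: "n \<ge> 1" and f: "f \<in> ops A n"
    and two: "\<And>x y. valid_args A n x \<Longrightarrow> valid_args A n y \<Longrightarrow> \<exists>g. (n, g) \<in> C \<and> g x = f x \<and> g y = f y"
    and S: "finite S" "\<forall>x\<in>S. valid_args A n x"
  shows "\<exists>g. (n, g) \<in> C \<and> (\<forall>x\<in>S. g x = f x)"
  using S
proof (induction "card S" arbitrary: S rule: less_induct)
  case less
  consider "S = {}" | x where "S = {x}" | x y where "S = {x, y}"
    | x y z where "x \<in> S" "y \<in> S" "z \<in> S" "x \<noteq> y" "x \<noteq> z" "y \<noteq> z"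
  proof (cases "\<exists>x y. S \<subseteq> {x, y}")
    case True
    then obtain x y where "S \<subseteq> {x, y}" by blast
    then have "S = {} \<or> S = {x} \<or> S = {y} \<or> S = {x, y}" by auto
    then show thesis using that(1-3) by (elim disjE)
  next
    case False
    then obtain x where "x \<in> S" by blast
    moreover obtain y where "y \<in> S" "x \<noteq> y" using False by blast
    moreover obtain z where "z \<in> S" "x \<noteq> z" "y \<noteq> z" using False by blast
    ultimately show thesis using that(4) by blast
  qed
  then show ?case
  proof cases
    case 1
    have "(n, proj A n 0) \<in> C" using clone_proj[OF cl] n by simp
    then show ?thesis using 1 by blast
  next
    case 2
    then show ?thesis using two[of x x] less.prems by auto
  next
    case 3
    then show ?thesis using two[of x y] less.prems by auto
  next
    case 4
    obtain m where m: "(3, m) \<in> C"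
      "\<forall>x\<in>A. \<forall>y\<in>A. m [x, y, y] = y \<and> m [y, x, y] = y \<and> m [y, y, x] = y"
      using maj by (auto simp: has_majority_def)
    have ex: "\<exists>g. (n, g) \<in> C \<and> (\<forall>u\<in>S - {v}. g u = f u)" if "v \<in> S" for v
      using less.hyps[of "S - {v}", OF card_Diff1_less] that less.prems by auto
    obtain g1 g2 g3 where g: "(n, g1) \<in> C" "(n, g2) \<in> C" "(n, g3) \<in> C"
      "\<forall>u\<in>S - {x}. g1 u = f u" "\<forall>u\<in>S - {y}. g2 u = f u" "\<forall>u\<in>S - {z}. g3 u = f u"
      using ex[OF 4(1)] ex[OF 4(2)] ex[OF 4(3)] by blast
    define h where "h = compose A n m [g1, g2, g3]"
    have "(n, h) \<in> C"
      unfolding h_def using g n by (intro clone_compose[OF cl m(1)]) auto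
    moreover have "h u = f u" if u: "u \<in> S" for u
    proof -
      have v: "valid_args A n u" using u less.prems by blast
      have in_A: "g u \<in> A" if "(n, g) \<in> C" for g using clone_ops[OF cl that] v by (simp add: ops_def)
      have "f u \<in> A" using f v by (simp add: ops_def)
      \<comment> \<open>The point \<open>u\<close> is omitted from at most one of the three sets, so
        at least two interpolants are correct at \<open>u\<close>.\<close>
      moreover have "(g1 u = f u \<and> g2 u = f u) \<or> (g1 u = f u \<and> g3 u = f u) \<or> (g2 u = f u \<and> g3 u = f u)"
        using g(4-6) u 4 by auto
      ultimately show ?thesis using m(2) in_A g v by (auto simp: h_def compose_def)
    qed
    ultimately show ?thesis by blast
  qed
qed

lemma clone_mem_if_agree_on_pairs:
  assumes "finite A" "is_clone A C" "has_majority A C" "n \<ge> 1" "f \<in> ops A n"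
    and "\<And>x y. valid_args A n x \<Longrightarrow> valid_args A n y \<Longrightarrow> \<exists>g. (n, g) \<in> C \<and> g x = f x \<and> g y = f y"
  shows "(n, f) \<in> C"
proof -
  obtain g where g: "(n, g) \<in> C" "\<forall>x\<in>{xs. valid_args A n xs}. g x = f x"
    using clone_agree_on[OF assms(2-6) finite_valid_args[OF assms(1)]] by blast
  have "g \<in> ops A n" using g assms(2) clone_ops by blast
  \<comment> \<open>Both functions are \<open>undefined\<close> off the valid arguments, so
    agreement on these is equality.\<close>
  then have "g = f" using g assms(5) by (fastforce simp: ops_def fun_eq_iff)
  then show ?thesis using g by simp
qed

section \<open>Membership in an arithmetical clone\<close>

definition inv_rel :: "(nat \<times> (nat list \<Rightarrow> nat)) set \<Rightarrow> (nat \<Rightarrow> nat \<Rightarrow> bool) \<Rightarrow> bool" where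
  "inv_rel C r \<longleftrightarrow> (\<forall>(n, f) \<in> C. pres n f r)"

lemma inv_relD: "inv_rel C r \<Longrightarrow> (n, f) \<in> C \<Longrightarrow> pres n f r"
  by (auto simp: inv_rel_def)

lemma inv_rel_OO: "inv_rel C r \<Longrightarrow> inv_rel C s \<Longrightarrow> inv_rel C (r OO s)"
  by (auto simp: inv_rel_def intro: pres_OO)

lemma inv_rel_conv: "inv_rel C r \<Longrightarrow> inv_rel C (r\<inverse>\<inverse>)"
  by (auto simp: inv_rel_def intro: pres_conv)

lemma clone_preserves_rels:
  assumes "is_clone A C"
  shows "clone_preserves C mu2 \<longleftrightarrow> inv_rel C mu" "clone_preserves C rho2 \<longleftrightarrow> inv_rel C rho"
    "clone_preserves C psi2 \<longleftrightarrow> inv_rel C psi"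
proof -
  note n = clone_arity[OF assms]
  show "clone_preserves C mu2 \<longleftrightarrow> inv_rel C mu" "clone_preserves C rho2 \<longleftrightarrow> inv_rel C rho"
    "clone_preserves C psi2 \<longleftrightarrow> inv_rel C psi"
    unfolding clone_preserves_def inv_rel_def using n preserves_op_rels by fastforce+
qed

text \<open>A Mal'cev and a majority operation together characterize arithmetical varieties, hence
  the name.\<close>

locale arithmetical_clone =
  fixes C :: "(nat \<times> (nat list \<Rightarrow> nat)) set"
  assumes clone: "is_clone D3 C" and idem: "idempotent_clone D3 C" and malcev: "malcev_clone D3 C"
    and majority: "has_majority D3 C" and inv_mu: "inv_rel C mu"
begin

text \<open>The Mal'cev operation, applied to the pairs \<open>(a, b)\<close>,
  \<open>(a, b')\<close>, \<open>(a', b')\<close>, returns \<open>(a', b)\<close>.\<close>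

lemma inv_rel_rectangular:
  assumes "inv_rel C r"
  shows "rectangular r"
  unfolding rectangular_def
proof (intro ballI impI)
  fix a b a' b' assume D: "a \<in> D3" "b \<in> D3" "a' \<in> D3" "b' \<in> D3" and r: "r a b" "r a b'" "r a' b'"
  obtain d where d: "(3, d) \<in> C" "\<forall>x\<in>D3. \<forall>y\<in>D3. d [y, x, x] = y \<and> d [x, x, y] = y"
    using malcev by (auto simp: malcev_clone_def)
  have "list_all2 r [a, a, a'] [b, b', b']" using r by simp
  from presD[OF inv_relD[OF assms d(1)] _ this] have "r (d [a, a, a']) (d [b, b', b'])" by simp
  then show "r a' b" using d(2) D by simp
qed

lemma inv_rel_cases:
  assumes "inv_rel C r" "bounded r"
  obtains B where "B \<in> {\<lambda>_ _. True, (=), mu}" "cut_by r B"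
    | B where "B \<in> {rho, psi, neq, iso 0, iso 1, (iso 0)\<inverse>\<inverse>, (iso 1)\<inverse>\<inverse>}" "inv_rel C B" "cut_by r B"
proof -
  have i: "inv_rel C (r OO mu)" "inv_rel C (mu OO r)" "inv_rel C (mu OO r OO mu)"
    using assms inv_mu by (simp_all add: inv_rel_OO)
  have inv: "inv_rel C B" if "B \<in> {r, r OO mu, mu OO r, mu OO r OO mu}" for B
    using that i assms by (elim insertE) simp_all
  from rectangular_cases[OF assms(2) inv_rel_rectangular[OF assms(1)] inv_rel_rectangular[OF i(1)]
      inv_rel_rectangular[OF i(2)] inv_rel_rectangular[OF i(3)]]
  show thesis
  proof (elim disjE bexE conjE)
    fix B assume "B \<in> {\<lambda>_ _. True, (=), mu}" "cut_by r B"
    then show thesis by (rule that(1))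
  next
    fix B assume B: "B \<in> {rho, psi, neq, iso 0, iso 1, (iso 0)\<inverse>\<inverse>, (iso 1)\<inverse>\<inverse>}"
      "B \<in> {r, r OO mu, mu OO r, mu OO r OO mu}" "cut_by r B"
    show thesis using B(1) inv[OF B(2)] B(3) by (rule that(2))
  qed
qed

text \<open>Every binary relation generated by a pair of tuples is one of the few rectangular relations
  compatible with \<open>mu\<close>, so only these have to be tested.\<close>

lemma clone_memI:
  assumes n: "n \<ge> 1" and f: "f \<in> ops D3 n"
    and conservative: "\<And>x. valid_args D3 n x \<Longrightarrow> f x \<in> set x"
    and mu: "pres n f mu"
    and others: "\<And>B. B \<in> {rho, psi, neq, iso 0, iso 1} \<Longrightarrow> inv_rel C B \<Longrightarrow> pres n f B"
  shows "(n, f) \<in> C"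
proof (rule clone_mem_if_agree_on_pairs[OF _ clone majority n f])
  show "finite D3" by (simp add: D3_def)
next
  fix x y assume x: "valid_args D3 n x" and y: "valid_args D3 n y"
  \<comment> \<open>This is the binary invariant relation generated by the pairs
    \<open>(x ! i, y ! i)\<close>; projections yield the generators and composition yields
    invariance.\<close>
  define r where "r a b \<longleftrightarrow> (\<exists>g. (n, g) \<in> C \<and> g x = a \<and> g y = b)" for a b
  have bd: "bounded r"
    using clone_ops[OF clone] x y by (auto simp: bounded_def r_def ops_def)
  have l: "length x = n" "length y = n" using x y by (auto simp: valid_args_def)
  have "inv_rel C r"
    unfolding inv_rel_def pres_def
  proof (clarify)
    fix h us vs assume h: "(length us, h) \<in> C" and us: "list_all2 r us vs"
    have "\<forall>i<length us. \<exists>g. (n, g) \<in> C \<and> g x = us ! i \<and> g y = vs ! i"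
      using us by (auto simp: list_all2_conv_all_nth r_def)
    then obtain G where G: "\<forall>i<length us. (n, G i) \<in> C \<and> G i x = us ! i \<and> G i y = vs ! i" by metis
    define gs where "gs = map G [0..<length us]"
    have "length vs = length us" using us by (simp add: list_all2_lengthD)
    then have *: "map (\<lambda>g. g x) gs = us" "map (\<lambda>g. g y) gs = vs"
      using G us by (auto simp: gs_def intro!: nth_equalityI)
    have "(n, compose D3 n h gs) \<in> C"
      using G by (intro clone_compose[OF clone h n]) (auto simp: gs_def)
    then show "r (h us) (h vs)"
      unfolding r_def by (intro exI[of _ "compose D3 n h gs"]) (simp add: compose_def x y *)
  qed
  have xy: "list_all2 r x y"
    unfolding list_all2_conv_all_nth
  proof (intro conjI allI impI)
    show "length x = length y" using l by simp
    fix i assume "i < length x"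
    then have "(n, proj D3 n i) \<in> C" using clone_proj[OF clone] l by simp
    then show "r (x ! i) (y ! i)"
      unfolding r_def by (intro exI[of _ "proj D3 n i"]) (simp add: proj_def x y)
  qed
  have D: "f x \<in> D3" "f y \<in> D3" using f x y by (auto simp: ops_def)
  \<comment> \<open>Conservativity makes \<open>f x\<close> an entry of \<open>x\<close> and
    \<open>f y\<close> an entry of \<open>y\<close>, so they lie in the projections of
    \<open>r\<close>.\<close>
  have row: "\<exists>b\<in>D3. r (f x) b" and col: "\<exists>a\<in>D3. r a (f y)"
    using conservative[OF x] conservative[OF y] xy bd
    by (fastforce simp: in_set_conv_nth list_all2_conv_all_nth bounded_def)+
  have sub: "B (f x) (f y) \<Longrightarrow> cut_by r B \<Longrightarrow> r (f x) (f y)" for B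
    using row col D unfolding cut_by_def by blast
  have B_xy: "list_all2 B x y" if "cut_by r B" for B
    using xy
  proof (rule list_all2_mono)
    show "B a b" if "r a b" for a b using that bd \<open>cut_by r B\<close> unfolding cut_by_def bounded_def by blast
  qed
  have "r (f x) (f y)"
    using \<open>inv_rel C r\<close> bd
  proof (cases rule: inv_rel_cases)
    case (1 B)
    have "B (f x) (f y)"
      using 1(1) B_xy[OF 1(2)] presD[OF mu l(1)] by (auto simp: list.rel_eq)
    then show ?thesis using 1(2) by (rule sub)
  next
    case (2 B)
    have "pres n f B"
    proof (cases "B \<in> {rho, psi, neq, iso 0, iso 1}")
      case True
      then show ?thesis using 2(2) by (rule others)
    next
      \<comment> \<open>Only the converses of \<open>iso 0\<close> and \<open>iso 1\<close> remain,
        and preservation passes to converses.\<close>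
      case False
      then obtain e where e: "B = (iso e)\<inverse>\<inverse>" "e = 0 \<or> e = 1" using 2(1) by auto
      then have "inv_rel C (iso e)" using inv_rel_conv[OF 2(2)] by simp
      then show ?thesis using others[of "iso e"] e pres_conv by auto
    qed
    then show ?thesis using presD[OF _ l(1) B_xy[OF 2(3)]] by (intro sub[OF _ 2(3)])
  qed
  then show "\<exists>g. (n, g) \<in> C \<and> g x = f x \<and> g y = f y" by (simp add: r_def)
qed

end

section \<open>Minor-preserving maps given by ternary minors\<close>

definition sel :: "nat \<Rightarrow> nat \<Rightarrow> nat \<Rightarrow> nat \<Rightarrow> nat" where
  "sel a b c v = (if v = 0 then a else if v = 1 then b else c)"

text \<open>The default 0 off \<open>A\<close> makes ternary minors equal as functions as soon as
  they agree on \<open>A\<close>.\<close>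

definition tern :: "nat set \<Rightarrow> (nat list \<Rightarrow> nat) \<Rightarrow> nat list \<Rightarrow> nat \<Rightarrow> nat \<Rightarrow> nat \<Rightarrow> nat" where
  "tern A f x = (\<lambda>a b c. if a \<in> A \<and> b \<in> A \<and> c \<in> A then f (map (sel a b c) x) else 0)"

text \<open>Any map \<open>\<phi>\<close> from ternary operations to \<open>D3\<close> yields a minor-preserving map, since \<open>tern A f x\<close> is
  the ternary minor of \<open>f\<close> whose variables are identified according to \<open>x\<close>.\<close>

definition lift_tern where
  "lift_tern A \<phi> n f = (\<lambda>x. if valid_args D3 n x then \<phi> (tern A f x) else undefined)"

definition indep1 :: "nat set \<Rightarrow> (nat \<Rightarrow> nat \<Rightarrow> nat \<Rightarrow> nat) \<Rightarrow> bool" where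
  "indep1 A h \<longleftrightarrow> (\<forall>a\<in>A. \<forall>a'\<in>A. \<forall>b\<in>A. \<forall>c\<in>A. h a b c = h a' b c)"
definition indep2 :: "nat set \<Rightarrow> (nat \<Rightarrow> nat \<Rightarrow> nat \<Rightarrow> nat) \<Rightarrow> bool" where
  "indep2 A h \<longleftrightarrow> (\<forall>a\<in>A. \<forall>b\<in>A. \<forall>b'\<in>A. \<forall>c\<in>A. h a b c = h a b' c)"
definition indep3 :: "nat set \<Rightarrow> (nat \<Rightarrow> nat \<Rightarrow> nat \<Rightarrow> nat) \<Rightarrow> bool" where
  "indep3 A h \<longleftrightarrow> (\<forall>a\<in>A. \<forall>b\<in>A. \<forall>c\<in>A. \<forall>c'\<in>A. h a b c = h a b c')"

text \<open>An argument list that omits a value gives a ternary minor without the corresponding variable;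
  the three independence tests therefore make the lifted operation conservative.\<close>

definition glue where
  "glue A t u v h = (if t h then 2 else if indep2 A h then 0 else if indep1 A h then 1
     else if indep3 A h then u h else v h)"

text \<open>Taking the minor along \<sigma> and then identifying variables by \<open>x\<close>
  amounts to identifying them by \<open>x\<close> composed with \<sigma>; both sides apply \<phi> to
  that ternary minor.\<close>

lemma minor_lift_tern:
  assumes "\<sigma> ` {..<n} \<subseteq> {..<r}"
  shows "lift_tern A \<phi> r (minor A n f r \<sigma>) = minor D3 n (lift_tern A \<phi> n f) r \<sigma>"
proof
  fix x
  show "lift_tern A \<phi> r (minor A n f r \<sigma>) x = minor D3 n (lift_tern A \<phi> n f) r \<sigma> x"
  proof (cases "valid_args D3 r x")
    case True
    then have l: "length x = r" and x: "set x \<subseteq> D3" by (auto simp: valid_args_def)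
    have \<sigma>: "\<sigma> i < length x" if "i < n" for i using assms that l by auto
    have "valid_args D3 n (map (\<lambda>i. x ! \<sigma> i) [0..<n])"
      using subsetD[OF x nth_mem[OF \<sigma>]] by (auto simp: valid_args_def)
    moreover have "tern A (minor A n f r \<sigma>) x = tern A f (map (\<lambda>i. x ! \<sigma> i) [0..<n])"
    proof (intro ext)
      fix a b c
      have "map (\<lambda>i. map (sel a b c) x ! \<sigma> i) [0..<n] = map (sel a b c) (map (\<lambda>i. x ! \<sigma> i) [0..<n])"
        using \<sigma> by simp
      moreover have "valid_args A r (map (sel a b c) x)" if "a \<in> A" "b \<in> A" "c \<in> A"
        using that l by (auto simp: valid_args_def sel_def)
      ultimately show "tern A (minor A n f r \<sigma>) x a b c = tern A f (map (\<lambda>i. x ! \<sigma> i) [0..<n]) a b c"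
        by (simp add: tern_def minor_def del: map_map map_eq_conv)
    qed
    ultimately show ?thesis using True by (simp add: lift_tern_def minor_def)
  qed (simp add: lift_tern_def minor_def)
qed

lemma minion_le_lift_tern:
  assumes "\<And>n f. (n, f) \<in> E \<Longrightarrow> (n, lift_tern A \<phi> n f) \<in> C"
  shows "minion_le A E D3 C"
  unfolding minion_le_def minion_hom_def
  by (rule exI[of _ "lift_tern A \<phi>"]) (auto simp: assms minor_lift_tern)

lemma indep_tern:
  "0 \<notin> set x \<Longrightarrow> indep1 A (tern A f x)" "1 \<notin> set x \<Longrightarrow> indep2 A (tern A f x)"
  "set x \<subseteq> D3 \<Longrightarrow> 2 \<notin> set x \<Longrightarrow> indep3 A (tern A f x)"
proof -
  have "map (sel a b c) x = map (sel a' b c) x" if "0 \<notin> set x" for a a' b c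
    using that by (auto simp: sel_def)
  then show "0 \<notin> set x \<Longrightarrow> indep1 A (tern A f x)" unfolding indep1_def tern_def by metis
  have "map (sel a b c) x = map (sel a b' c) x" if "1 \<notin> set x" for a b b' c
    using that by (auto simp: sel_def)
  then show "1 \<notin> set x \<Longrightarrow> indep2 A (tern A f x)" unfolding indep2_def tern_def by metis
  \<comment> \<open>\<open>sel\<close> sends every value other than 0 and 1 to its third argument,
    so here \<open>x\<close> must also lie over \<open>D3\<close>.\<close>
  have "map (sel a b c) x = map (sel a b c') x" if "set x \<subseteq> D3" "2 \<notin> set x" for a b c c'
    using that by (auto simp: sel_def D3_def)
  then show "set x \<subseteq> D3 \<Longrightarrow> 2 \<notin> set x \<Longrightarrow> indep3 A (tern A f x)" unfolding indep3_def tern_def by metis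
qed

lemma list_all2_map_eq: "list_all2 r x y \<Longrightarrow> (\<And>a b. r a b \<Longrightarrow> g a = k b) \<Longrightarrow> map g x = map k y"
  by (induction rule: list_all2_induct) auto

lemma list_all2_mapI: "list_all2 r x y \<Longrightarrow> (\<And>a b. r a b \<Longrightarrow> s (g a) (k b)) \<Longrightarrow> list_all2 s (map g x) (map k y)"
  by (induction rule: list_all2_induct) auto

lemma bounded_valid_args:
  assumes "bounded r" "list_all2 r x y" "length x = n"
  shows "valid_args D3 n x" "valid_args D3 n y"
proof -
  have "set x \<subseteq> D3 \<and> set y \<subseteq> D3"
    using assms(2) by (induction rule: list_all2_induct) (use assms(1) in \<open>auto simp: bounded_def\<close>)
  then show "valid_args D3 n x" "valid_args D3 n y"
    using assms by (auto simp: valid_args_def dest: list_all2_lengthD)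
qed

text \<open>The test \<open>t\<close> alone decides the class modulo \<open>mu\<close>, which
  settles \<open>mu\<close> and \<open>rho\<close>. For \<open>neq\<close>, and on the left side of
  \<open>iso e\<close>, lists omit 2, and there only \<open>u\<close> counts. The conditions
  \<open>t3\<close>, \<open>t12\<close>, \<open>u13\<close> and \<open>u23\<close> keep the choices
  consistent when variables are irrelevant.\<close>

lemma (in arithmetical_clone) glue_mem:
  fixes A f t u v n
  defines "H \<equiv> tern A f"
  assumes n: "n \<ge> 1"
    and t3: "\<And>x. valid_args D3 n x \<Longrightarrow> indep3 A (H x) \<Longrightarrow> \<not> t (H x)"
    and t12: "\<And>x. valid_args D3 n x \<Longrightarrow> indep1 A (H x) \<Longrightarrow> indep2 A (H x) \<Longrightarrow> t (H x)"
    and uv: "\<And>x. valid_args D3 n x \<Longrightarrow> \<not> t (H x) \<Longrightarrow> u (H x) \<in> D2 \<and> v (H x) \<in> D2"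
    and u13: "\<And>x. valid_args D3 n x \<Longrightarrow> indep1 A (H x) \<Longrightarrow> indep3 A (H x) \<Longrightarrow> u (H x) = 1"
    and u23: "\<And>x. valid_args D3 n x \<Longrightarrow> indep2 A (H x) \<Longrightarrow> indep3 A (H x) \<Longrightarrow> u (H x) = 0"
    and mu: "\<And>x y. list_all2 mu x y \<Longrightarrow> length x = n \<Longrightarrow> t (H x) = t (H y)"
    and rho: "\<And>x y. inv_rel C rho \<Longrightarrow> list_all2 rho x y \<Longrightarrow> length x = n \<Longrightarrow> t (H x) = (\<not> t (H y))"
    and psi: "\<And>x y. inv_rel C psi \<Longrightarrow> list_all2 psi x y \<Longrightarrow> length x = n \<Longrightarrow>
        psi (glue A t u v (H x)) (glue A t u v (H y))"
    and neq: "\<And>x y. inv_rel C neq \<Longrightarrow> list_all2 neq x y \<Longrightarrow> length x = n \<Longrightarrow> neq (u (H x)) (u (H y))"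
    and iso: "\<And>e x y. e \<in> D2 \<Longrightarrow> inv_rel C (iso e) \<Longrightarrow> list_all2 (iso e) x y \<Longrightarrow> length x = n \<Longrightarrow>
        t (H y) = (u (H x) \<noteq> e)"
  shows "(n, lift_tern A (glue A t u v) n f) \<in> C"
proof -
  let ?F = "lift_tern A (glue A t u v) n f"
  have F: "?F x = glue A t u v (H x)" if "valid_args D3 n x" for x
    using that by (simp add: lift_tern_def H_def)
  \<comment> \<open>The value 2 excludes \<open>indep3\<close> by \<open>t3\<close>. If
    \<open>t\<close> fails, \<open>t12\<close> forbids that \<open>indep1\<close> and
    \<open>indep2\<close> both hold, so the chosen value from \<open>D2\<close> occurs in
    \<open>x\<close>.\<close>
  have cons: "?F x \<in> set x" if x: "valid_args D3 n x" for x
  proof -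
    have "set x \<subseteq> D3" using x by (auto simp: valid_args_def)
    then have "0 \<in> set x \<or> indep1 A (H x)" "1 \<in> set x \<or> indep2 A (H x)" "2 \<in> set x \<or> indep3 A (H x)"
      unfolding H_def using indep_tern by blast+
    then show ?thesis
      unfolding F[OF x] glue_def using t3[OF x] t12[OF x] uv[OF x]
      by (auto simp: D2_def split: if_splits)
  qed
  have D3: "?F x \<in> D3" if "valid_args D3 n x" for x
    using cons[OF that] that by (auto simp: valid_args_def)
  have F2: "?F x = 2 \<longleftrightarrow> t (H x)" if "valid_args D3 n x" for x
    using uv[OF that] by (auto simp: F[OF that] glue_def D2_def)
  \<comment> \<open>Here \<open>indep3\<close> holds, and by \<open>u13\<close> and
    \<open>u23\<close> the earlier branches of \<open>glue\<close> give the same value as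
    \<open>u\<close>.\<close>
  have Fu: "?F x = u (H x)" if x: "valid_args D3 n x" "2 \<notin> set x" for x
  proof -
    have "set x \<subseteq> D3" using x by (auto simp: valid_args_def)
    then have "indep3 A (H x)" using x indep_tern(3) by (simp add: H_def)
    then show ?thesis using t3[OF x(1)] u13[OF x(1)] u23[OF x(1)] by (simp add: F[OF x(1)] glue_def)
  qed
  show ?thesis
  proof (rule clone_memI[OF n _ cons])
    show "?F \<in> ops D3 n" using D3 by (auto simp: ops_def lift_tern_def)
    show "pres n ?F mu"
      unfolding pres_def
    proof (intro allI impI)
      fix x y assume a: "length x = n" "list_all2 mu x y"
      note vs = bounded_valid_args[OF bounded_mu a(2,1)]
      show "mu (?F x) (?F y)"
        using D3[OF vs(1)] D3[OF vs(2)] F2[OF vs(1)] F2[OF vs(2)] mu[OF a(2,1)] by (simp add: mu_def)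
    qed
    fix B assume B: "B \<in> {rho, psi, neq, iso 0, iso 1}" and inv: "inv_rel C B"
    show "pres n ?F B"
      unfolding pres_def
    proof (intro allI impI)
      fix x y assume a: "length x = n" "list_all2 B x y"
      have "bounded B" using B by (auto simp: bounded_rho bounded_psi bounded_neq bounded_iso)
      note vs = bounded_valid_args[OF this a(2,1)]
      consider "B = rho" | "B = psi" | "B = neq" | e where "B = iso e" "e \<in> D2"
        using B by (auto simp: D2_def)
      then show "B (?F x) (?F y)"
      proof cases
        case 1
        then show ?thesis
          using D3[OF vs(1)] D3[OF vs(2)] F2[OF vs(1)] F2[OF vs(2)] rho a inv by (simp add: rho_def)
      next
        case 2
        then show ?thesis using psi a inv by (simp add: F vs)
      next
        case 3
        then have "2 \<notin> set x \<and> 2 \<notin> set y"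
          using a(2) by (auto simp: neq_def list_all2_conv_all_nth in_set_conv_nth)
        then show ?thesis using 3 neq a inv by (simp add: Fu vs)
      next
        case 4
        then have x2: "2 \<notin> set x"
          using a(2) by (auto simp: iso_def D2_def list_all2_conv_all_nth in_set_conv_nth)
        then have "?F x \<noteq> 2" using cons[OF vs(1)] by auto
        then have "?F x \<in> D2" using D3[OF vs(1)] by (auto simp: D2_def D3_def)
        then show ?thesis
          using 4 iso[OF 4(2)] a inv x2 D3[OF vs(2)] F2[OF vs(2)] by (simp add: iso_def Fu vs)
      qed
    qed
  qed
qed

section \<open>Constructing operations of the clone\<close>

lemma D2_mem [simp]: "0 \<in> D2" "1 \<in> D2" "Suc 0 \<in> D2" "2 \<notin> D2"
  by (auto simp: D2_def)

lemma indep1D: "indep1 A h \<Longrightarrow> a \<in> A \<Longrightarrow> a' \<in> A \<Longrightarrow> b \<in> A \<Longrightarrow> c \<in> A \<Longrightarrow> h a b c = h a' b c"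
  and indep2D: "indep2 A h \<Longrightarrow> a \<in> A \<Longrightarrow> b \<in> A \<Longrightarrow> b' \<in> A \<Longrightarrow> c \<in> A \<Longrightarrow> h a b c = h a b' c"
  and indep3D: "indep3 A h \<Longrightarrow> a \<in> A \<Longrightarrow> b \<in> A \<Longrightarrow> c \<in> A \<Longrightarrow> c' \<in> A \<Longrightarrow> h a b c = h a b c'"
  unfolding indep1_def indep2_def indep3_def by blast+

lemma I2_iff: "(n, f) \<in> I2 \<longleftrightarrow> n \<ge> 1 \<and> f \<in> ops D2 n \<and> (\<forall>c\<in>D2. f (replicate n c) = c)"
  by (auto simp: I2_def Pol_def preserves_op_singleton D2_def)

lemma C2_iff: "(n, f) \<in> C2 \<longleftrightarrow> (n, f) \<in> I2 \<and> pres n f neq"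
  by (auto simp: C2_def I2_def Pol_def preserves_op_rels)

lemma PolM1_iff: "(n, f) \<in> PolM1 \<longleftrightarrow> n \<ge> 1 \<and> f \<in> ops D3 n \<and> pres n f psi \<and> pres n f mu
    \<and> (\<forall>c\<in>D3. f (replicate n c) = c)"
  by (auto simp: PolM1_def Pol_def preserves_op_singleton preserves_op_rels D3_def)

text \<open>Each \<open>rho\<close> step changes the class modulo \<open>mu\<close>, so two steps
  return to it.\<close>

lemma mu_eq_rho_OO_rho: "mu = rho OO rho"
proof (intro ext iffI)
  fix a b assume "mu a b"
  then have "rho a (if a = 2 then 0 else 2)" "rho (if a = 2 then 0 else 2) b"
    by (auto simp: mu_def rho_def)
  then show "(rho OO rho) a b" by blast
qed (auto simp: mu_def rho_def)

text \<open>\<open>D2\<close> is the class of 0 modulo \<open>mu\<close>, and \<open>f\<close> fixes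
  0.\<close>

lemma pres_mu_D2:
  assumes "pres n f mu" "f (replicate n 0) = 0" "length x = n" "set x \<subseteq> D2"
  shows "f x \<in> D2"
proof -
  have "list_all2 mu x (replicate n 0)"
    using assms(3,4) by (auto simp: list_all2_conv_all_nth mu_def D2_def D3_def dest!: nth_mem)
  from presD[OF assms(1,3) this] show ?thesis using assms(2) by (auto simp: mu_def D2_def D3_def)
qed

text \<open>\<open>mu\<close> is recovered from \<open>rho\<close>, and the subuniverse
  \<open>D2\<close> from \<open>mu\<close> and idempotence.\<close>

lemma PolM0_iff: "(n, f) \<in> PolM0 \<longleftrightarrow> (n, f) \<in> PolM1 \<and> pres n f rho"
proof -
  have D2: "{[0], [1]} = {[a] | a. a \<in> D2}" by (auto simp: D2_def)
  have "(n, f) \<in> PolM0 \<longleftrightarrow> n \<ge> 1 \<and> f \<in> ops D3 n \<and> pres n f psi \<and> pres n f rho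
    \<and> (\<forall>x. length x = n \<longrightarrow> (\<forall>a\<in>set x. a \<in> D2) \<longrightarrow> f x \<in> D2) \<and> (\<forall>c\<in>D3. f (replicate n c) = c)"
    unfolding PolM0_def Pol_def D2
    by (auto simp: preserves_op_singleton preserves_op_rels preserves_op_unary D3_def)
  moreover have "pres n f rho \<Longrightarrow> pres n f mu"
    unfolding mu_eq_rho_OO_rho by (rule pres_OO)
  ultimately show ?thesis
    unfolding PolM1_iff using pres_mu_D2[of n f, unfolded subset_eq] by auto
qed

lemma tern_eq: "a \<in> A \<Longrightarrow> b \<in> A \<Longrightarrow> c \<in> A \<Longrightarrow> tern A f x a b c = f (map (sel a b c) x)"
  by (simp add: tern_def)

lemma tern_012:
  assumes "valid_args D3 n x"
  shows "tern D3 f x 0 1 2 = f x"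
proof -
  have "map (sel 0 1 2) x = x"
    using assms by (intro map_idI) (auto simp: valid_args_def sel_def D3_def)
  then show ?thesis by (simp add: tern_eq)
qed

lemma tern_idem: "f (replicate (length x) a) = a \<Longrightarrow> a \<in> A \<Longrightarrow> tern A f x a a a = a"
proof -
  have "map (sel a a a) x = replicate (length x) a" by (induction x) (auto simp: sel_def)
  then show "f (replicate (length x) a) = a \<Longrightarrow> a \<in> A \<Longrightarrow> tern A f x a a a = a" by (simp add: tern_def)
qed

text \<open>The lifted operation acts as \<open>f\<close> on \<open>D2\<close>. It also acts as
  \<open>f\<close> on the quotient by \<open>mu\<close>, with \<open>e\<close> coding the class
  \<open>{0, 1}\<close> and \<open>1 - e\<close> the class of 2. The constant choice of
  \<open>v\<close> is admissible because \<open>psi\<close> is not invariant.\<close>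

lemma (in arithmetical_clone) two_element_glue_mem:
  fixes e n f
  defines "t \<equiv> \<lambda>h::nat \<Rightarrow> nat \<Rightarrow> nat \<Rightarrow> nat. h e e (1 - e) = 1 - e"
  assumes f: "(n, f) \<in> I2" and e: "e \<in> D2" and psi: "\<not> inv_rel C psi"
    and self_dual: "inv_rel C rho \<or> inv_rel C neq \<Longrightarrow> pres n f neq"
    and iso: "\<And>e'. e' \<in> D2 \<Longrightarrow> inv_rel C (iso e') \<Longrightarrow> e' = e \<or> pres n f neq"
  shows "(n, lift_tern D2 (glue D2 t (\<lambda>h. h 0 1 0) (\<lambda>_. 0)) n f) \<in> C"
proof -
  define d where "d = 1 - e"
  have ed: "e = 0 \<and> d = 1 \<or> e = 1 \<and> d = 0" using e by (auto simp: D2_def d_def)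
  then have e': "d \<in> D2" "d \<noteq> e" by auto
  have t_def: "t = (\<lambda>h. h e e d = d)" unfolding t_def d_def ..
  note te = tern_eq[OF e e e'(1)]
  have id: "tern D2 f x a a a = a" if "valid_args D3 n x" "a \<in> D2" for x a
    using that f tern_idem[of f x a D2] by (auto simp: I2_iff valid_args_def)
  have fD2: "f x \<in> D2" if "length x = n" "set x \<subseteq> D2" for x
    using f that by (auto simp: I2_iff ops_def valid_args_def)
  show ?thesis
  proof (rule glue_mem, goal_cases)
    case 1
    then show ?case using f by (simp add: I2_iff)
  next
    case (2 x)
    have "tern D2 f x e e d = tern D2 f x e e e" by (rule indep3D[OF 2(2)]) (use e e' in simp_all)
    then show ?case using id[OF 2(1) e] e' by (simp add: t_def)
  next
    case (3 x)
    have "tern D2 f x e e d = tern D2 f x d e d" by (rule indep1D[OF 3(2)]) (use e e' in simp_all)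
    also have "\<dots> = tern D2 f x d d d" by (rule indep2D[OF 3(3)]) (use e e' in simp_all)
    finally show ?case using id[OF 3(1) e'(1)] by (simp add: t_def)
  next
    case (4 x)
    have "f (map (sel 0 1 0) x) \<in> D2"
      using 4 by (intro fD2) (auto simp: valid_args_def sel_def)
    then show ?case by (simp add: tern_def)
  next
    case (5 x)
    have "tern D2 f x 0 1 0 = tern D2 f x 1 1 0" by (rule indep1D[OF 5(2)]) simp_all
    also have "\<dots> = tern D2 f x 1 1 1" by (rule indep3D[OF 5(3)]) simp_all
    finally show ?case using id[OF 5(1), of 1] by simp
  next
    case (6 x)
    have "tern D2 f x 0 1 0 = tern D2 f x 0 0 0" by (rule indep2D[OF 6(2)]) simp_all
    then show ?case using id[OF 6(1), of 0] by simp
  next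
    case (7 x y)
    have "map (sel e e d) x = map (sel e e d) y"
      using 7(1) by (rule list_all2_map_eq) (auto simp: mu_def sel_def D3_def)
    then show ?case by (simp add: t_def te)
  next
    case (8 x y)
    have "list_all2 neq (map (sel e e d) x) (map (sel e e d) y)"
      using 8(2) by (rule list_all2_mapI) (use ed in \<open>auto simp: rho_def neq_def sel_def D3_def D2_def\<close>)
    from presD[OF self_dual _ this] 8 show ?case unfolding t_def te using ed by (auto simp: neq_def)
  next
    case (9 x y)
    then show ?case using psi by simp
  next
    case (10 x y)
    have "list_all2 neq (map (sel 0 1 0) x) (map (sel 0 1 0) y)"
      using 10(2) by (rule list_all2_mapI) (auto simp: neq_def sel_def)
    from presD[OF self_dual _ this] 10 show ?case by (simp add: tern_eq)
  next
    case (11 e' x y)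
    have x: "set x \<subseteq> D2" using 11(3) by (auto simp: iso_def list_all2_conv_all_nth in_set_conv_nth)
    then have "map (sel 0 1 0) x = x"
      by (intro map_idI) (auto simp: sel_def D2_def)
    then have u: "tern D2 f x 0 1 0 = f x" by (simp add: tern_eq)
    have fx: "f x \<in> D2" using fD2 x 11 by simp
    show ?case
    proof (cases "e' = e")
      case True
      \<comment> \<open>For the matching isomorphism, the list \<open>x\<close> is precisely the
        coding of \<open>y\<close>.\<close>
      have "map (\<lambda>v. v) x = map (sel e e d) y"
        using 11(3) by (rule list_all2_map_eq) (use True ed in \<open>auto simp: iso_def sel_def D2_def D3_def\<close>)
      then show ?thesis unfolding t_def te u using fx ed True by (auto simp: D2_def)
    next
      case False
      \<comment> \<open>For the other isomorphism, \<open>x\<close> is the complement of the coding,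
        and self-duality of \<open>f\<close> compensates.\<close>
      then have nq: "pres n f neq" using iso 11 by blast
      have "list_all2 neq (map (\<lambda>v. v) x) (map (sel e e d) y)"
        using 11(3) by (rule list_all2_mapI) (use False ed 11(1) in \<open>auto simp: iso_def neq_def sel_def D2_def D3_def\<close>)
      from presD[OF nq _ this] 11(4) have "neq (f x) (f (map (sel e e d) y))" by simp
      then show ?thesis unfolding t_def te u using fx ed 11(1) False by (auto simp: D2_def neq_def)
    qed
  qed
qed

text \<open>Since \<open>tern D3 f x 0 1 2\<close> is \<open>f x\<close>, the lifted operation
  differs from \<open>f\<close> only where an independence test intervenes. The choice of
  \<open>u\<close> stays open for lists with irrelevant third variable.\<close>

lemma (in arithmetical_clone) PolM1_glue_mem:
  fixes n f u
  defines "t \<equiv> \<lambda>h::nat \<Rightarrow> nat \<Rightarrow> nat \<Rightarrow> nat. h 0 1 2 = 2"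
  assumes f: "(n, f) \<in> PolM1"
    and u: "\<And>x. valid_args D3 n x \<Longrightarrow> f x \<noteq> 2 \<Longrightarrow> u (tern D3 f x) \<in> D2"
    and u13: "\<And>x. valid_args D3 n x \<Longrightarrow> indep1 D3 (tern D3 f x) \<Longrightarrow> indep3 D3 (tern D3 f x) \<Longrightarrow> u (tern D3 f x) = 1"
    and u23: "\<And>x. valid_args D3 n x \<Longrightarrow> indep2 D3 (tern D3 f x) \<Longrightarrow> indep3 D3 (tern D3 f x) \<Longrightarrow> u (tern D3 f x) = 0"
    and psi: "\<And>x y. list_all2 psi x y \<Longrightarrow> length x = n \<Longrightarrow> indep3 D3 (tern D3 f x) \<Longrightarrow> f x \<noteq> 2
        \<Longrightarrow> neq (u (tern D3 f x)) (u (tern D3 f y))"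
    and rho: "inv_rel C rho \<Longrightarrow> pres n f rho"
    and iso: "\<And>e x y. e \<in> D2 \<Longrightarrow> inv_rel C (iso e) \<Longrightarrow> list_all2 (iso e) x y \<Longrightarrow> length x = n \<Longrightarrow>
        f y = 2 \<longleftrightarrow> u (tern D3 f x) \<noteq> e"
  shows "(n, lift_tern D3 (glue D3 t u (\<lambda>h. h 0 1 2)) n f) \<in> C"
proof -
  have id: "tern D3 f x a a a = a" if "valid_args D3 n x" "a \<in> D3" for x a
    using that f tern_idem[of f x a D3] by (auto simp: PolM1_iff valid_args_def)
  have h: "tern D3 f x 0 1 2 = f x" if "valid_args D3 n x" for x
    using that by (rule tern_012)
  have t: "t (tern D3 f x) \<longleftrightarrow> f x = 2" if "valid_args D3 n x" for x
    using h[OF that] by (simp add: t_def)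
  have pmu: "pres n f mu" and ppsi: "pres n f psi" and c0: "f (replicate n 0) = 0"
    and ops: "f \<in> ops D3 n" using f by (auto simp: PolM1_iff)
  \<comment> \<open>An irrelevant third argument may be set to 0; then all arguments lie in
    \<open>D2\<close>, and so does the value.\<close>
  have t3: "\<not> t (tern D3 f x)" if "valid_args D3 n x" "indep3 D3 (tern D3 f x)" for x
  proof -
    have "tern D3 f x 0 1 2 = tern D3 f x 0 1 0" by (rule indep3D[OF that(2)]) simp_all
    moreover have "f (map (sel 0 1 0) x) \<in> D2"
      using that by (intro pres_mu_D2[OF pmu c0]) (auto simp: valid_args_def sel_def)
    ultimately show ?thesis by (auto simp: t_def tern_eq)
  qed
  have t12: "t (tern D3 f x)" if "valid_args D3 n x" "indep1 D3 (tern D3 f x)" "indep2 D3 (tern D3 f x)" for x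
  proof -
    have "tern D3 f x 0 1 2 = tern D3 f x 2 1 2" by (rule indep1D[OF that(2)]) simp_all
    also have "\<dots> = tern D3 f x 2 2 2" by (rule indep2D[OF that(3)]) simp_all
    finally show ?thesis using id[OF that(1), of 2] by (simp add: t_def)
  qed
  show ?thesis
  proof (rule glue_mem, goal_cases)
    case 1
    then show ?case using f by (simp add: PolM1_iff)
  next
    case (2 x)
    then show ?case by (rule t3)
  next
    case (3 x)
    then show ?case by (rule t12)
  next
    case (4 x)
    have "f x \<in> D3" using ops 4 by (auto simp: ops_def)
    then show ?case using 4 u h t by (auto simp: D2_def D3_def)
  next
    case (5 x)
    then show ?case by (rule u13)
  next
    case (6 x)
    then show ?case by (rule u23)
  next
    case (7 x y)
    note vs = bounded_valid_args[OF bounded_mu 7]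
    show ?case using presD[OF pmu 7(2,1)] by (simp add: t vs mu_def)
  next
    case (8 x y)
    note vs = bounded_valid_args[OF bounded_rho 8(2,3)]
    show ?case using presD[OF rho 8(3,2)] 8(1) by (auto simp: t vs rho_def)
  next
    case (9 x y)
    note vs = bounded_valid_args[OF bounded_psi 9(2,3)]
    have p: "psi (f x) (f y)" using presD[OF ppsi 9(3,2)] .
    \<comment> \<open>\<open>psi\<close> exchanges 0 and 1, so the ternary minors differ by
      exchanging their first two variables, and \<open>indep1\<close> and \<open>indep2\<close>
      trade places.\<close>
    have swap: "tern D3 f y a b c = tern D3 f x b a c" for a b c
    proof -
      have "map (sel b a c) x = map (sel a b c) y"
        using 9(2) by (rule list_all2_map_eq) (auto simp: psi_def sel_def)
      then show ?thesis by (simp add: tern_def)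
    qed
    have ind: "indep1 D3 (tern D3 f y) = indep2 D3 (tern D3 f x)"
      "indep2 D3 (tern D3 f y) = indep1 D3 (tern D3 f x)"
      "indep3 D3 (tern D3 f y) = indep3 D3 (tern D3 f x)"
      unfolding indep1_def indep2_def indep3_def swap by blast+
    show ?case
    proof (cases "f x = 2")
      case True
      then have "f y = 2" using p by (auto simp: psi_def)
      then show ?thesis using True by (simp add: glue_def t vs psi_def)
    next
      case False
      then have "f y \<noteq> 2" using p by (auto simp: psi_def)
      \<comment> \<open>By \<open>t12\<close> at most one of \<open>indep1\<close> and
        \<open>indep2\<close> holds, so the values 0 and 1 that \<open>glue\<close> assigns in these
        branches are exchanged as \<open>psi\<close> demands.\<close>
      then show ?thesis
        using False p psi[OF 9(2,3)] t12[OF vs(1)] unfolding glue_def ind h[OF vs(1)] h[OF vs(2)]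
        by (auto simp: t vs psi_def neq_def)
    qed
  next
    case (10 x y)
    have p: "list_all2 psi x y" using 10(2) by (rule list_all2_mono) (auto simp: neq_def psi_def)
    note vs = bounded_valid_args[OF bounded_neq 10(2,3)]
    have "set x \<subseteq> D3" "2 \<notin> set x"
      using 10(2) vs by (auto simp: neq_def valid_args_def list_all2_conv_all_nth in_set_conv_nth)
    then have i3: "indep3 D3 (tern D3 f x)" by (rule indep_tern)
    then show ?case using psi[OF p 10(3)] t3[OF vs(1)] by (simp add: t vs)
  next
    case (11 e x y)
    note vs = bounded_valid_args[OF bounded_iso 11(3,4)]
    then show ?case using iso[OF 11] t by simp
  qed
qed

section \<open>Comparison of the clones\<close>

definition reflect where
  "reflect B e p n f = (\<lambda>x. if valid_args B n x then p (f (map e x)) else undefined)"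

text \<open>Applying \<open>e\<close> to each entry commutes with rearranging the entries, and
  \<open>p\<close> acts only on the result.\<close>

lemma minor_reflect:
  assumes "\<sigma> ` {..<n} \<subseteq> {..<r}" "\<forall>b\<in>B. e b \<in> A"
  shows "reflect B e p r (minor A n f r \<sigma>) = minor B n (reflect B e p n f) r \<sigma>"
proof
  fix x
  show "reflect B e p r (minor A n f r \<sigma>) x = minor B n (reflect B e p n f) r \<sigma> x"
  proof (cases "valid_args B r x")
    case True
    then have l: "length x = r" and x: "set x \<subseteq> B" by (auto simp: valid_args_def)
    have \<sigma>: "\<sigma> i < length x" if "i < n" for i using assms that l by auto
    have "valid_args B n (map (\<lambda>i. x ! \<sigma> i) [0..<n])"
      using subsetD[OF x nth_mem[OF \<sigma>]] by (auto simp: valid_args_def)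
    moreover have "valid_args A r (map e x)"
      using l subsetD[OF x] assms(2) by (auto simp: valid_args_def)
    moreover have "map (\<lambda>i. map e x ! \<sigma> i) [0..<n] = map e (map (\<lambda>i. x ! \<sigma> i) [0..<n])"
      using \<sigma> by simp
    ultimately show ?thesis
      using True by (simp add: reflect_def minor_def del: map_map map_eq_conv)
  qed (simp add: reflect_def minor_def)
qed

lemma minion_le_reflect:
  assumes "\<forall>b\<in>B. e b \<in> A" "\<And>n f. (n, f) \<in> C \<Longrightarrow> (n, reflect B e p n f) \<in> D"
  shows "minion_le A C B D"
  unfolding minion_le_def minion_hom_def
  by (rule exI[of _ "reflect B e p"]) (auto simp: assms minor_reflect)

lemma minion_le_subset: "C \<subseteq> D \<Longrightarrow> minion_le A C A D"
  unfolding minion_le_def minion_hom_def by (rule exI[of _ "\<lambda>n f. f"]) auto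

lemma minion_le_trans:
  assumes "minion_le A C B D" "minion_le B D B' E"
  shows "minion_le A C B' E"
proof -
  obtain \<xi> \<zeta> where h: "minion_hom A C B D \<xi>" "minion_hom B D B' E \<zeta>"
    using assms by (auto simp: minion_le_def)
  have "minion_hom A C B' E (\<lambda>n f. \<zeta> n (\<xi> n f))"
    using h unfolding minion_hom_def by (auto split: prod.splits)
  then show ?thesis by (auto simp: minion_le_def)
qed

lemma minion_hom_mem: "minion_hom A C B D \<xi> \<Longrightarrow> (n, f) \<in> C \<Longrightarrow> (n, \<xi> n f) \<in> D"
  by (auto simp: minion_hom_def)

text \<open>Transports an identity between minors, which is how the separating conditions are
  used.\<close>

lemma minion_hom_minor_eq:
  assumes "minion_hom A C B D \<xi>" "(n, f) \<in> C" "(m, g) \<in> C" "1 \<le> r"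
    "\<sigma> ` {..<n} \<subseteq> {..<r}" "\<tau> ` {..<m} \<subseteq> {..<r}"
    and "minor A n f r \<sigma> = minor A m g r \<tau>"
  shows "minor B n (\<xi> n f) r \<sigma> = minor B m (\<xi> m g) r \<tau>"
proof -
  have "\<xi> r (minor A k h r \<upsilon>) = minor B k (\<xi> k h) r \<upsilon>"
    if "(k, h) \<in> C" "\<upsilon> ` {..<k} \<subseteq> {..<r}" for k h \<upsilon>
    using assms(1,4) that unfolding minion_hom_def by blast
  from this[OF assms(2,5)] this[OF assms(3,6)] assms(7) show ?thesis by simp
qed

lemma restrict_mem_I2:
  assumes "n \<ge> 1" "f \<in> ops D3 n" "pres n f mu" "\<forall>c\<in>D3. f (replicate n c) = c"
  shows "(n, reflect D2 (\<lambda>v. v) (\<lambda>v. v) n f) \<in> I2"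
proof -
  have "f x \<in> D2" if "valid_args D2 n x" for x
    using that assms by (intro pres_mu_D2) (auto simp: valid_args_def)
  then show ?thesis
    using assms by (auto simp: I2_iff reflect_def ops_def valid_args_def D3_def D2_def)
qed

lemma neq_valid_args:
  assumes "length x = n" "list_all2 neq x y"
  shows "valid_args D2 n x" "valid_args D2 n y"
proof -
  have "set x \<subseteq> D2 \<and> set y \<subseteq> D2"
    using assms(2) by (induction rule: list_all2_induct) (auto simp: neq_def)
  then show "valid_args D2 n x" "valid_args D2 n y"
    using assms by (auto simp: valid_args_def dest: list_all2_lengthD)
qed

lemma restrict_mem_C2:
  assumes "n \<ge> 1" "f \<in> ops D3 n" "pres n f mu" "\<forall>c\<in>D3. f (replicate n c) = c" "pres n f neq"
  shows "(n, reflect D2 (\<lambda>v. v) (\<lambda>v. v) n f) \<in> C2"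
  unfolding C2_iff
proof (intro conjI restrict_mem_I2 assms)
  show "pres n (reflect D2 (\<lambda>v. v) (\<lambda>v. v) n f) neq"
    unfolding pres_def
  proof (intro allI impI)
    fix x y assume a: "length x = n" "list_all2 neq x y"
    show "neq (reflect D2 (\<lambda>v. v) (\<lambda>v. v) n f x) (reflect D2 (\<lambda>v. v) (\<lambda>v. v) n f y)"
      using presD[OF assms(5) a] neq_valid_args[OF a] by (simp add: reflect_def)
  qed
qed

text \<open>The quotient by \<open>mu\<close> is read off on the representatives 0 and 2, where
  \<open>rho\<close> becomes \<open>neq\<close>.\<close>

lemma quotient_mem_C2:
  assumes "n \<ge> 1" "f \<in> ops D3 n" "\<forall>c\<in>D3. f (replicate n c) = c" "pres n f rho"
  shows "(n, reflect D2 (\<lambda>v. 2 * v) (\<lambda>v. if v = 2 then 1 else 0) n f) \<in> C2"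
    (is "(n, ?F) \<in> C2")
proof -
  have "?F \<in> ops D2 n" by (auto simp: reflect_def ops_def)
  moreover have "?F (replicate n c) = c" if "c \<in> D2" for c
    using assms that by (auto simp: reflect_def valid_args_def D2_def)
  moreover have "pres n ?F neq"
    unfolding pres_def
  proof (intro allI impI)
    fix x y assume a: "length x = n" "list_all2 neq x y"
    note v = neq_valid_args[OF a]
    have "list_all2 rho (map (\<lambda>v. 2 * v) x) (map (\<lambda>v. 2 * v) y)"
      using a(2) by (rule list_all2_mapI) (auto simp: rho_def neq_def)
    from presD[OF assms(4) _ this] a(1) have "rho (f (map (\<lambda>v. 2 * v) x)) (f (map (\<lambda>v. 2 * v) y))" by simp
    then show "neq (?F x) (?F y)"
      using v by (auto simp: reflect_def rho_def neq_def)
  qed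
  ultimately show ?thesis using assms by (simp add: C2_iff I2_iff)
qed

text \<open>\<open>neq\<close> is \<open>psi\<close> restricted to \<open>D2\<close>, which is a
  class of \<open>mu\<close>.\<close>

lemma pres_neq:
  assumes "pres n f psi" "pres n f mu" "f (replicate n 0) = 0"
  shows "pres n f neq"
  unfolding pres_def
proof (intro allI impI)
  fix x y assume a: "length x = n" "list_all2 neq x y"
  have "list_all2 psi x y" using a(2) by (rule list_all2_mono) (auto simp: neq_def psi_def)
  from presD[OF assms(1) a(1) this] have "psi (f x) (f y)" .
  moreover have "f x \<in> D2"
    using neq_valid_args[OF a] by (intro pres_mu_D2[OF assms(2,3)]) (auto simp: valid_args_def)
  ultimately show "neq (f x) (f y)" by (auto simp: psi_def neq_def D2_def)
qed

lemma PolM0_le_PolM1: "minion_le D3 PolM0 D3 PolM1"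
  by (rule minion_le_subset) (auto simp: PolM0_iff)

lemma PolM1_le_C2: "minion_le D3 PolM1 D2 C2"
  by (rule minion_le_reflect[OF _ restrict_mem_C2]) (auto simp: PolM1_iff D2_def D3_def intro: pres_neq)

lemma C2_le_I2: "minion_le D2 C2 D2 I2"
  by (rule minion_le_subset) (auto simp: C2_iff)

text \<open>The two identifications of \<open>D2\<close> with the quotient differ by the swap, so a
  clone that preserves both preserves \<open>neq\<close>.\<close>

lemma neq_eq_iso: "neq = iso 0 OO (iso 1)\<inverse>\<inverse>"
proof (intro ext iffI)
  fix a b assume "neq a b"
  then have "iso 0 a (if a = 0 then 0 else 2)" "iso 1 b (if a = 0 then 0 else 2)"
    by (auto simp: neq_def iso_def)
  then show "(iso 0 OO (iso 1)\<inverse>\<inverse>) a b" by blast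
qed (auto simp: neq_def iso_def D2_def)

text \<open>\<open>rho\<close> is disequality on the quotient, that is, \<open>neq\<close>
  transported along \<open>iso e\<close>.\<close>

lemma rho_eq_iso:
  assumes "e \<in> D2"
  shows "rho = (iso e)\<inverse>\<inverse> OO neq OO iso e"
proof (intro ext iffI)
  fix a b assume "rho a b"
  then have "iso e (if a = 2 then 1 - e else e) a" "neq (if a = 2 then 1 - e else e) (if b = 2 then 1 - e else e)"
    "iso e (if b = 2 then 1 - e else e) b"
    using assms by (auto simp: rho_def neq_def iso_def D2_def)
  then show "((iso e)\<inverse>\<inverse> OO neq OO iso e) a b" by blast
qed (use assms in \<open>auto simp: rho_def neq_def iso_def D2_def\<close>)

section \<open>The three cases of the classification\<close>

context arithmetical_clone
begin

lemma mem_facts: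
  assumes "(n, f) \<in> C"
  shows "n \<ge> 1" "f \<in> ops D3 n" "pres n f mu" "\<forall>c\<in>D3. f (replicate n c) = c"
  using assms clone_arity[OF clone] clone_ops[OF clone] inv_relD[OF inv_mu] idem
  by (auto simp: idempotent_clone_def)

lemma inv_neq: "inv_rel C psi \<Longrightarrow> inv_rel C neq"
  using mem_facts by (auto simp: inv_rel_def intro!: pres_neq)

text \<open>\<open>C2\<close> occurs when \<open>rho\<close> or \<open>neq\<close> forces
  self-duality, on the quotient or on \<open>D2\<close> respectively; otherwise \<open>I2\<close>
  occurs.\<close>

lemma not_inv_psi_cases:
  assumes psi: "\<not> inv_rel C psi"
  shows "minion_eq D3 C D2 C2 \<or> minion_eq D3 C D2 I2"
proof (cases "inv_rel C rho \<or> inv_rel C neq")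
  case True
  have "minion_le D3 C D2 C2"
  proof (cases "inv_rel C neq")
    case True
    show ?thesis
      by (rule minion_le_reflect[OF _ restrict_mem_C2])
        (use mem_facts inv_relD[OF True] in \<open>auto simp: D2_def D3_def\<close>)
  next
    case False
    then have "inv_rel C rho" using True by blast
    then show ?thesis
      by (intro minion_le_reflect[OF _ quotient_mem_C2])
        (use mem_facts inv_relD[of C rho] in \<open>auto simp: D2_def D3_def\<close>)
  qed
  moreover have "minion_le D2 C2 D3 C"
    by (rule minion_le_lift_tern[OF two_element_glue_mem[where e = 0]])
      (use psi in \<open>auto simp: C2_iff\<close>)
  ultimately show ?thesis by (simp add: minion_eq_def)
next
  case False
  \<comment> \<open>Both isomorphisms together would make \<open>neq\<close> invariant, so at most
    one is, and the coding follows it.\<close>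
  define e :: nat where "e = (if inv_rel C (iso 1) then 1 else 0)"
  have "minion_le D3 C D2 I2"
    by (rule minion_le_reflect[OF _ restrict_mem_I2])
      (use mem_facts in \<open>auto simp: D2_def D3_def\<close>)
  moreover have "minion_le D2 I2 D3 C"
  proof (rule minion_le_lift_tern[OF two_element_glue_mem[where e = e]])
    show "e \<in> D2" by (simp add: e_def)
    fix e' assume e': "e' \<in> D2" "inv_rel C (iso e')"
    have "\<not> (inv_rel C (iso 0) \<and> inv_rel C (iso 1))"
      using False inv_rel_OO[OF _ inv_rel_conv, of C "iso 0" "iso 1"] by (auto simp: neq_eq_iso)
    then have "e' = e" using e' by (auto simp: e_def D2_def)
    then show "e' = e \<or> pres n f neq" for n f ..
  qed (use psi False in auto)
  ultimately show ?thesis by (simp add: minion_eq_def)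
qed

text \<open>With \<open>psi\<close>, and hence \<open>neq\<close>, an invariant \<open>iso e\<close>
  would yield \<open>rho\<close>. So the isomorphisms impose no condition, and \<open>u\<close> can
  be the value of \<open>f\<close> itself.\<close>

lemma inv_psi_not_inv_rho:
  assumes psi: "inv_rel C psi" and rho: "\<not> inv_rel C rho"
  shows "minion_eq D3 C D3 PolM1"
proof -
  have "C \<subseteq> PolM1" using mem_facts inv_relD[OF psi] by (auto simp: PolM1_iff)
  moreover have "minion_le D3 PolM1 D3 C"
  proof (rule minion_le_lift_tern[OF PolM1_glue_mem[where u = "\<lambda>h. h 0 1 2"]])
    fix n f assume f: "(n, f) \<in> PolM1"
    have h: "tern D3 f x 0 1 2 = f x" if "valid_args D3 n x" for x
      using that by (rule tern_012)
    have id: "tern D3 f x a a a = a" if "valid_args D3 n x" "a \<in> D3" for x a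
      using that f tern_idem[of f x a D3] by (auto simp: PolM1_iff valid_args_def)
    show "(n, f) \<in> PolM1" by fact
    show "tern D3 f x 0 1 2 \<in> D2" if "valid_args D3 n x" "f x \<noteq> 2" for x
    proof -
      have "f x \<in> D3" using f that by (auto simp: PolM1_iff ops_def)
      then show ?thesis using that h by (auto simp: D2_def D3_def)
    qed
    show "tern D3 f x 0 1 2 = 1"
      if "valid_args D3 n x" "indep1 D3 (tern D3 f x)" "indep3 D3 (tern D3 f x)" for x
    proof -
      have "tern D3 f x 0 1 2 = tern D3 f x 1 1 2" by (rule indep1D[OF that(2)]) simp_all
      also have "\<dots> = tern D3 f x 1 1 1" by (rule indep3D[OF that(3)]) simp_all
      finally show ?thesis using id[OF that(1), of 1] by simp
    qed
    show "tern D3 f x 0 1 2 = 0"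
      if "valid_args D3 n x" "indep2 D3 (tern D3 f x)" "indep3 D3 (tern D3 f x)" for x
    proof -
      have "tern D3 f x 0 1 2 = tern D3 f x 0 0 2" by (rule indep2D[OF that(2)]) simp_all
      also have "\<dots> = tern D3 f x 0 0 0" by (rule indep3D[OF that(3)]) simp_all
      finally show ?thesis using id[OF that(1), of 0] by simp
    qed
    show "neq (tern D3 f x 0 1 2) (tern D3 f y 0 1 2)"
      if "list_all2 psi x y" "length x = n" "f x \<noteq> 2" for x y
    proof -
      have "psi (f x) (f y)" using f that by (auto simp: PolM1_iff intro: presD)
      then show ?thesis
        using that(3) h bounded_valid_args[OF bounded_psi that(1,2)] by (auto simp: psi_def neq_def)
    qed
    show "pres n f rho" if "inv_rel C rho" using rho that by blast
    show "f y = 2 \<longleftrightarrow> tern D3 f x 0 1 2 \<noteq> e" if "e \<in> D2" "inv_rel C (iso e)" for e x y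
    proof -
      have "inv_rel C rho"
        unfolding rho_eq_iso[OF that(1)] using inv_neq[OF psi] that(2)
        by (intro inv_rel_OO inv_rel_conv)
      then show ?thesis using rho by blast
    qed
  qed
  ultimately show ?thesis by (simp add: minion_eq_def minion_le_subset)
qed

text \<open>Some \<open>iso e\<close> may now be invariant, so on \<open>D2\<close> the lifted
  operation copies the action of \<open>f\<close> on the quotient: \<open>?u\<close> codes 1 by 2 in
  the arguments and decodes 2 to 1.\<close>

lemma inv_psi_inv_rho:
  assumes psi: "inv_rel C psi" and rho: "inv_rel C rho"
  shows "minion_eq D3 C D3 PolM0"
proof -
  let ?u = "\<lambda>h :: nat \<Rightarrow> nat \<Rightarrow> nat \<Rightarrow> nat. if h 0 2 0 = 2 then 1 else 0"
  have "C \<subseteq> PolM0" using mem_facts inv_relD[OF psi] inv_relD[OF rho] by (auto simp: PolM0_iff PolM1_iff)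
  moreover have "minion_le D3 PolM0 D3 C"
  proof (rule minion_le_lift_tern[OF PolM1_glue_mem[where u = ?u]])
    fix n f assume f: "(n, f) \<in> PolM0"
    then have prho: "pres n f rho" and pmu: "pres n f mu" by (auto simp: PolM0_iff PolM1_iff)
    have id: "tern D3 f x a a a = a" if "valid_args D3 n x" "a \<in> D3" for x a
      using that f tern_idem[of f x a D3] by (auto simp: PolM0_iff PolM1_iff valid_args_def)
    show "(n, f) \<in> PolM1" using f by (simp add: PolM0_iff)
    show "?u (tern D3 f x) \<in> D2" for x by simp
    show "?u (tern D3 f x) = 1"
      if "valid_args D3 n x" "indep1 D3 (tern D3 f x)" "indep3 D3 (tern D3 f x)" for x
    proof -
      have "tern D3 f x 0 2 0 = tern D3 f x 2 2 0" by (rule indep1D[OF that(2)]) simp_all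
      also have "\<dots> = tern D3 f x 2 2 2" by (rule indep3D[OF that(3)]) simp_all
      finally show ?thesis using id[OF that(1), of 2] by simp
    qed
    show "?u (tern D3 f x) = 0"
      if "valid_args D3 n x" "indep2 D3 (tern D3 f x)" "indep3 D3 (tern D3 f x)" for x
    proof -
      have "tern D3 f x 0 2 0 = tern D3 f x 0 0 0" by (rule indep2D[OF that(2)]) simp_all
      then show ?thesis using id[OF that(1), of 0] by simp
    qed
    show "neq (?u (tern D3 f x)) (?u (tern D3 f y))"
      if xy: "list_all2 psi x y" "length x = n" and i3: "indep3 D3 (tern D3 f x)" for x y
    proof -
      have "map (sel 2 0 0) x = map (sel 0 2 0) y"
        using xy(1) by (rule list_all2_map_eq) (auto simp: psi_def sel_def)
      then have "tern D3 f y 0 2 0 = tern D3 f x 2 0 0" by (simp add: tern_eq)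
      \<comment> \<open>Changing the irrelevant third argument to 2 makes the list the entrywise
        \<open>rho\<close>-opposite of \<open>map (sel 0 2 0) x\<close>.\<close>
      also have "\<dots> = tern D3 f x 2 0 2" by (rule indep3D[OF i3]) simp_all
      finally have y: "tern D3 f y 0 2 0 = f (map (sel 2 0 2) x)" by (simp add: tern_eq)
      have "list_all2 rho (map (sel 0 2 0) x) (map (sel 2 0 2) x)"
        by (rule list_all2_mapI[of "(=)"]) (auto simp: rho_def sel_def list.rel_eq)
      from presD[OF prho _ this] xy(2) have "rho (f (map (sel 0 2 0) x)) (f (map (sel 2 0 2) x))"
        by simp
      then show ?thesis by (auto simp: y tern_eq rho_def neq_def)
    qed
    show "pres n f rho" by fact
    show "f y = 2 \<longleftrightarrow> ?u (tern D3 f x) \<noteq> e"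
      if e: "e \<in> D2" and xy: "list_all2 (iso e) x y" "length x = n" for e x y
    proof (cases "e = 0")
      case True
      have "list_all2 mu (map (sel 0 2 0) x) (map (\<lambda>v. v) y)"
        using xy(1) by (rule list_all2_mapI) (use True in \<open>auto simp: mu_def iso_def sel_def D2_def\<close>)
      from presD[OF pmu _ this] xy(2) have "mu (f (map (sel 0 2 0) x)) (f y)" by simp
      then show ?thesis using True by (auto simp: tern_eq mu_def)
    next
      case False
      then have "e = 1" using e by (simp add: D2_def)
      have "list_all2 rho (map (sel 0 2 0) x) (map (\<lambda>v. v) y)"
        using xy(1) by (rule list_all2_mapI) (use \<open>e = 1\<close> in \<open>auto simp: rho_def iso_def sel_def D2_def\<close>)
      from presD[OF prho _ this] xy(2) have "rho (f (map (sel 0 2 0) x)) (f y)" by simp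
      then show ?thesis using \<open>e = 1\<close> by (auto simp: tern_eq rho_def)
    qed
  qed
  ultimately show ?thesis by (simp add: minion_eq_def minion_le_subset)
qed

end

section \<open>Separation\<close>

lemma map_upt_2: "map g [0..<2] = [g 0, g 1]" and map_upt_3: "map g [0..<3] = [g 0, g 1, g 2]"
  by (simp_all add: numeral_2_eq_2 numeral_3_eq_3)

lemma valid_args_2: "valid_args A 2 x \<longleftrightarrow> (\<exists>a\<in>A. \<exists>b\<in>A. x = [a, b])"
  and valid_args_3: "valid_args A 3 x \<longleftrightarrow> (\<exists>a\<in>A. \<exists>b\<in>A. \<exists>c\<in>A. x = [a, b, c])"
  by (auto simp: valid_args_def numeral_2_eq_2 numeral_3_eq_3 length_Suc_conv)

lemma lessThan_2: "{..<2::nat} = {0, 1}" and lessThan_3: "{..<3::nat} = {0, 1, 2}"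
  by auto

lemma replicate_2: "replicate 2 c = [c, c]" and replicate_3: "replicate 3 c = [c, c, c]"
  by (simp_all add: numeral_2_eq_2 numeral_3_eq_3)

lemma pres_3:
  "pres 3 f r \<longleftrightarrow> (\<forall>a b c a' b' c'. r a a' \<longrightarrow> r b b' \<longrightarrow> r c c' \<longrightarrow> r (f [a, b, c]) (f [a', b', c']))"
  by (auto simp: pres_def numeral_3_eq_3 length_Suc_conv list_all2_Cons1)

definition swap01 :: "nat \<Rightarrow> nat" where "swap01 i = (if i = 0 then 1 else if i = 1 then 0 else i)"

text \<open>Separating minor condition: \<open>f(x,y) = f(y,x)\<close>.\<close>

lemma I2_not_le_C2: "\<not> minion_le D2 I2 D2 C2"
proof
  assume "minion_le D2 I2 D2 C2"
  then obtain \<xi> where hom: "minion_hom D2 I2 D2 C2 \<xi>" by (auto simp: minion_le_def)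
  define f where "f x = (if valid_args D2 2 x then min (x ! 0) (x ! 1) else undefined)" for x
  have f: "(2, f) \<in> I2"
    by (auto simp: I2_iff ops_def f_def valid_args_2 replicate_2 D2_def)
  have "minor D2 2 f 2 swap01 = minor D2 2 f 2 id"
    by (auto simp: fun_eq_iff minor_def map_upt_2 swap01_def f_def valid_args_2)
  from minion_hom_minor_eq[OF hom f f _ _ _ this]
  have "minor D2 2 (\<xi> 2 f) 2 swap01 = minor D2 2 (\<xi> 2 f) 2 id" by (auto simp: swap01_def lessThan_2)
  from fun_cong[OF this, of "[0, 1]"] have "\<xi> 2 f [1, 0] = \<xi> 2 f [0, 1]"
    by (simp add: minor_def map_upt_2 swap01_def valid_args_2)
  moreover have "pres 2 (\<xi> 2 f) neq" using minion_hom_mem[OF hom f] by (simp add: C2_iff)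
  \<comment> \<open>Exchanging the arguments 0 and 1 complements them, so a self-dual operation
    cannot be symmetric.\<close>
  from presD[OF this, of "[0, 1]" "[1, 0]"] have "neq (\<xi> 2 f [0, 1]) (\<xi> 2 f [1, 0])"
    by (simp add: neq_def)
  ultimately show False by (auto simp: neq_def)
qed

text \<open>By symmetry and \<open>psi\<close>, the value at \<open>[0, 1, 2]\<close> is related to
  itself by \<open>psi\<close>, hence it is 2; \<open>mu\<close> carries this over to
  \<open>[0, 0, 2]\<close>.\<close>

lemma swap01_symmetric_012:
  assumes "(3, g) \<in> PolM1" "minor D3 3 g 3 swap01 = minor D3 3 g 3 id"
  shows "g [0, 0, 2] = 2"
proof -
  have "g [1, 0, 2] = g [0, 1, 2]"
    using fun_cong[OF assms(2), of "[0, 1, 2]"] by (simp add: minor_def map_upt_3 swap01_def valid_args_3)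
  moreover have "psi (g [0, 1, 2]) (g [1, 0, 2])"
    using assms(1) by (intro presD[of 3 g psi]) (auto simp: PolM1_iff psi_def)
  moreover have "mu (g [0, 1, 2]) (g [0, 0, 2])"
    using assms(1) by (intro presD[of 3 g mu]) (auto simp: PolM1_iff mu_def)
  ultimately show ?thesis by (auto simp: psi_def mu_def)
qed

text \<open>Separating minor condition: \<open>f(x,y,z) = f(y,x,z)\<close> and \<open>f(x,x,y) = f(x,x,x)\<close>.\<close>

lemma C2_not_le_PolM1: "\<not> minion_le D2 C2 D3 PolM1"
proof
  assume "minion_le D2 C2 D3 PolM1"
  then obtain \<xi> where hom: "minion_hom D2 C2 D3 PolM1 \<xi>" by (auto simp: minion_le_def)
  \<comment> \<open>On \<open>D2\<close> this is the majority operation, which is symmetric and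
    self-dual.\<close>
  define f where "f x = (if valid_args D2 3 x then if x ! 0 = x ! 1 then x ! 0 else x ! 2 else undefined)" for x
  have f: "(3, f) \<in> C2"
    by (auto simp: C2_iff I2_iff ops_def f_def valid_args_3 replicate_3 D2_def pres_3 neq_def)
  have "minor D2 3 f 3 swap01 = minor D2 3 f 3 id"
    by (auto simp: fun_eq_iff minor_def map_upt_3 swap01_def f_def valid_args_3 D2_def)
  from minion_hom_minor_eq[OF hom f f _ _ _ this]
  have "minor D3 3 (\<xi> 3 f) 3 swap01 = minor D3 3 (\<xi> 3 f) 3 id" by (auto simp: swap01_def lessThan_3)
  with minion_hom_mem[OF hom f] have "\<xi> 3 f [0, 0, 2] = 2" by (rule swap01_symmetric_012)
  moreover
  have "minor D2 3 f 2 (\<lambda>i. if i = 2 then 1 else 0) = minor D2 3 f 2 (\<lambda>_. 0)"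
    by (auto simp: fun_eq_iff minor_def map_upt_3 f_def valid_args_3 valid_args_2)
  from minion_hom_minor_eq[OF hom f f _ _ _ this]
  have "minor D3 3 (\<xi> 3 f) 2 (\<lambda>i. if i = 2 then 1 else 0) = minor D3 3 (\<xi> 3 f) 2 (\<lambda>_. 0)"
    by (auto simp: lessThan_3)
  from fun_cong[OF this, of "[0, 2]"] have "\<xi> 3 f [0, 0, 2] = \<xi> 3 f [0, 0, 0]"
    by (simp add: minor_def map_upt_3 valid_args_2)
  moreover have "\<xi> 3 f [0, 0, 0] = 0"
    using minion_hom_mem[OF hom f] by (simp add: PolM1_iff replicate_3 D3_def)
  ultimately show False by simp
qed

text \<open>Separating minor condition: \<open>f\<close> and \<open>g\<close> are symmetric in the first two variables, and
  \<open>f(y,y,x) = g(x,x,y)\<close>.\<close>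

lemma PolM1_not_le_PolM0: "\<not> minion_le D3 PolM1 D3 PolM0"
proof
  assume "minion_le D3 PolM1 D3 PolM0"
  then obtain \<xi> where hom: "minion_hom D3 PolM1 D3 PolM0 \<xi>" by (auto simp: minion_le_def)
  \<comment> \<open>On \<open>D2\<close> these are majority and minority; making 2 absorbing keeps
    \<open>psi\<close> and \<open>mu\<close> invariant.\<close>
  define f where "f x = (if valid_args D3 3 x then if 2 \<in> set x then 2
    else if x ! 0 = x ! 1 then x ! 0 else x ! 2 else undefined)" for x
  define g where "g x = (if valid_args D3 3 x then if 2 \<in> set x then 2
    else if x ! 0 = x ! 1 then x ! 2 else 1 - x ! 2 else undefined)" for x
  have f: "(3, f) \<in> PolM1"
    by (auto simp: PolM1_iff ops_def f_def valid_args_3 replicate_3 pres_3 psi_def mu_def)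
  have g: "(3, g) \<in> PolM1"
    by (auto simp: PolM1_iff ops_def g_def valid_args_3 replicate_3 pres_3 psi_def mu_def)
      (auto simp: D3_def)
  have swap: "\<xi> 3 h [0, 0, 2] = 2" if "(3, h) \<in> PolM1" "minor D3 3 h 3 swap01 = minor D3 3 h 3 id" for h
  proof -
    have "minor D3 3 (\<xi> 3 h) 3 swap01 = minor D3 3 (\<xi> 3 h) 3 id"
      using minion_hom_minor_eq[OF hom that(1,1) _ _ _ that(2)] by (auto simp: swap01_def lessThan_3)
    moreover have "(3, \<xi> 3 h) \<in> PolM1" using minion_hom_mem[OF hom that(1)] by (simp add: PolM0_iff)
    ultimately show ?thesis by (intro swap01_symmetric_012)
  qed
  have "minor D3 3 f 3 swap01 = minor D3 3 f 3 id"
    by (auto simp: fun_eq_iff minor_def map_upt_3 swap01_def f_def valid_args_3 D3_def)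
  with f have f2: "\<xi> 3 f [0, 0, 2] = 2" by (rule swap)
  have "minor D3 3 g 3 swap01 = minor D3 3 g 3 id"
    by (auto simp: fun_eq_iff minor_def map_upt_3 swap01_def g_def valid_args_3 D3_def)
  with g have g2: "\<xi> 3 g [0, 0, 2] = 2" by (rule swap)
  have "minor D3 3 f 2 (\<lambda>i. if i = 2 then 0 else 1) = minor D3 3 g 2 (\<lambda>i. if i = 2 then 1 else 0)"
    by (auto simp: fun_eq_iff minor_def map_upt_3 f_def g_def valid_args_3 valid_args_2)
  from minion_hom_minor_eq[OF hom f g _ _ _ this]
  have "minor D3 3 (\<xi> 3 f) 2 (\<lambda>i. if i = 2 then 0 else 1) = minor D3 3 (\<xi> 3 g) 2 (\<lambda>i. if i = 2 then 1 else 0)"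
    by (auto simp: lessThan_3)
  from fun_cong[OF this, of "[0, 2]"] have "\<xi> 3 f [2, 2, 0] = \<xi> 3 g [0, 0, 2]"
    by (simp add: minor_def map_upt_3 valid_args_2)
  \<comment> \<open>The two lists are opposite in every entry, yet both values would have to be
    2.\<close>
  moreover have "rho (\<xi> 3 f [2, 2, 0]) (\<xi> 3 f [0, 0, 2])"
    using minion_hom_mem[OF hom f] by (intro presD[of 3 "\<xi> 3 f" rho]) (auto simp: PolM0_iff rho_def)
  ultimately show False using f2 g2 by (simp add: rho_def)
qed

theorem theorem6p9:
  shows "(\<forall>C. is_clone D3 C \<and> idempotent_clone D3 C \<and> malcev_clone D3 C \<and> has_majority D3 C
              \<and> clone_preserves C mu2 \<longrightarrow>
           ((\<not> clone_preserves C psi2 \<longrightarrow> minion_eq D3 C D2 C2 \<or> minion_eq D3 C D2 I2)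
          \<and> (clone_preserves C psi2 \<and> \<not> clone_preserves C rho2 \<longrightarrow> minion_eq D3 C D3 PolM1)
          \<and> (clone_preserves C psi2 \<and> clone_preserves C rho2 \<longrightarrow> minion_eq D3 C D3 PolM0)))
   \<and> minion_le D3 PolM0 D3 PolM1 \<and> minion_le D3 PolM1 D2 C2 \<and> minion_le D2 C2 D2 I2
   \<and> \<not> minion_eq D3 PolM0 D3 PolM1 \<and> \<not> minion_eq D3 PolM0 D2 C2 \<and> \<not> minion_eq D3 PolM0 D2 I2
   \<and> \<not> minion_eq D3 PolM1 D2 C2 \<and> \<not> minion_eq D3 PolM1 D2 I2 \<and> \<not> minion_eq D2 C2 D2 I2"
proof (intro conjI allI impI)
  fix C
  assume C: "is_clone D3 C \<and> idempotent_clone D3 C \<and> malcev_clone D3 C \<and> has_majority D3 C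
    \<and> clone_preserves C mu2"
  then have clone: "is_clone D3 C" by blast
  note pres = clone_preserves_rels[OF clone]
  interpret arithmetical_clone C
    using C pres by unfold_locales auto
  show "minion_eq D3 C D2 C2 \<or> minion_eq D3 C D2 I2" if "\<not> clone_preserves C psi2"
    using not_inv_psi_cases that pres by blast
  show "minion_eq D3 C D3 PolM1" if "clone_preserves C psi2 \<and> \<not> clone_preserves C rho2"
    using inv_psi_not_inv_rho that pres by blast
  show "minion_eq D3 C D3 PolM0" if "clone_preserves C psi2 \<and> clone_preserves C rho2"
    using inv_psi_inv_rho that pres by blast
next
  show "minion_le D3 PolM0 D3 PolM1" "minion_le D3 PolM1 D2 C2" "minion_le D2 C2 D2 I2"
    by (rule PolM0_le_PolM1 PolM1_le_C2 C2_le_I2)+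
  show "\<not> minion_eq D3 PolM0 D3 PolM1" "\<not> minion_eq D3 PolM1 D2 C2" "\<not> minion_eq D2 C2 D2 I2"
    using PolM1_not_le_PolM0 C2_not_le_PolM1 I2_not_le_C2 by (auto simp: minion_eq_def)
  \<comment> \<open>For non-neighbours in the chain, a backward homomorphism composed with forward
    ones would contradict a separation of neighbours.\<close>
  show "\<not> minion_eq D3 PolM0 D2 C2"
    using C2_not_le_PolM1 minion_le_trans[OF _ PolM0_le_PolM1] by (auto simp: minion_eq_def)
  show "\<not> minion_eq D3 PolM1 D2 I2"
    using I2_not_le_C2 minion_le_trans[OF _ PolM1_le_C2] by (auto simp: minion_eq_def)
  then show "\<not> minion_eq D3 PolM0 D2 I2"
    using I2_not_le_C2 minion_le_trans[OF _ minion_le_trans[OF PolM0_le_PolM1 PolM1_le_C2]]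
    by (auto simp: minion_eq_def)
qed

end
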